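(* Assume that $\mathbb{P}(T=0)\ne1$ and let $a>0$ be given. Let $$V(x):=\sum_{n\ge0}e^{an}\,\mathbb{P}(T_n\le x),\qquad x\in\mathbb{R}.$$ (a) Assume that $\mathbb{P}(T<0)>0$. (i) If $a\in(0,R)$, then $V(x)$ is finite for every $x\in\mathbb{R}$. (ii) If $a=R>0$ and $$-\psi'(\gamma_0)=\mathbb{E}\,e^{-\gamma_0T}T>0,$$ then $V(x)$ is finite for every $x\in\mathbb{R}$. (iii) If $a>R$, then $V(x)=+\infty$ for all $x\in\mathbb{R}$. (iv) If $a=R>0$ and $\psi'(\gamma_0)=0$ (equivalently, if the condition $-\psi'(\gamma_0)>0$ in (ii) does not hold), then $V(x)=+\infty$ for all $x\in\mathbb{R}$. (b) Assume that $\mathbb{P}(T>0)=1$. Then $V(x)$ is finite for every $x\in\mathbb{R}$. (c) Assume that $\mathbb{P}(T\ge0)=1$ and $\beta:=\mathbb{P}(T=0)>0$. Then $R=-\log\beta$; if $a\in(0,R)$, then $V(x)$ is finite for every $x\in\mathbb{R}$; and if $a\ge R$, then $V(x)$ is infinite for all $x\ge0$.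
   Context: $T$ is a real-valued random variable (proper distribution) and $(T_n)_{n\ge0}$ is a zero-delayed random walk with step distribution that of $T$, i.e. $T_0=0$ and $T_n$ is a sum of $n$ independent copies of $T$. Its Laplace transform is $\psi:[0,\infty)\to(0,\infty]$, $\psi(t):=\mathbb{E}e^{-tT}$, and $\psi'$ denotes the left derivative of $\psi$. Put $R:=-\log\inf_{t\ge0}\psi(t)\in[0,\infty]$. Unless $T\ge0$ a.s., the infimum is attained, and $\gamma_0\in[0,\infty)$ denotes the point with $\psi(\gamma_0)=e^{-R}$ (one has $\gamma_0=0$ if and only if $R=0$). *)

theory Defs
  imports "HOL-Probability.Probability"
begin

text \<open>The transform \<open>\<psi>(t) = E exp(-tT)\<close> as an extended nonnegative number, so that the value
  \<open>\<infinity>\<close> is kept. Only arguments \<open>t \<ge> 0\<close> are relevant.\<close>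

definition laplace :: "'a measure \<Rightarrow> ('a \<Rightarrow> real) \<Rightarrow> real \<Rightarrow> ennreal" where
  "laplace N T t = (\<integral>\<^sup>+ \<omega>. ennreal (exp (- t * T \<omega>)) \<partial>N)"

definition laplace_inf :: "'a measure \<Rightarrow> ('a \<Rightarrow> real) \<Rightarrow> ennreal" where
  "laplace_inf N T = (INF t\<in>{0..}. laplace N T t)"

text \<open>\<open>R = - log inf \<psi>\<close>, with \<open>- log 0 = \<infinity>\<close>. On a probability space the infimum is at most
  \<open>\<psi>(0) = 1\<close>, so \<open>enn2real\<close> is only applied to finite values.\<close>

definition decay_rate :: "'a measure \<Rightarrow> ('a \<Rightarrow> real) \<Rightarrow> ereal" where
  "decay_rate N T =
     (if laplace_inf N T = 0 then \<infinity> else ereal (- ln (enn2real (laplace_inf N T))))"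

text \<open>The point \<open>\<gamma>\<^sub>0 \<ge> 0\<close> with \<open>\<psi>(\<gamma>\<^sub>0) = exp(-R) = inf \<psi>\<close>. If \<open>T < 0\<close> with positive
  probability, it exists, and it is unique because \<open>\<psi>\<close> is strictly convex where finite.\<close>

definition laplace_argmin :: "'a measure \<Rightarrow> ('a \<Rightarrow> real) \<Rightarrow> real" where
  "laplace_argmin N T = (THE t. 0 \<le> t \<and> laplace N T t = laplace_inf N T)"

text \<open>The left derivative of \<open>\<psi>\<close> at \<open>t\<close>. It is meaningful only for \<open>t > 0\<close> with \<open>\<psi>(t) < \<infinity>\<close>; then
  \<open>\<psi>\<close> is finite on \<open>[0,t]\<close> by convexity, so \<open>enn2real\<close> loses nothing to the left of \<open>t\<close>.\<close>

definition laplace_left_deriv :: "'a measure \<Rightarrow> ('a \<Rightarrow> real) \<Rightarrow> real \<Rightarrow> real" where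
  "laplace_left_deriv N T t = vector_derivative (\<lambda>s. enn2real (laplace N T s)) (at_left t)"

definition walk :: "(nat \<Rightarrow> 'b \<Rightarrow> real) \<Rightarrow> nat \<Rightarrow> 'b \<Rightarrow> real" where
  "walk X n \<omega> = (\<Sum>i<n. X i \<omega>)"

definition exp_renewal :: "'b measure \<Rightarrow> (nat \<Rightarrow> 'b \<Rightarrow> real) \<Rightarrow> real \<Rightarrow> real \<Rightarrow> ennreal" where
  "exp_renewal M X a x =
     (\<Sum>n. ennreal (exp (a * real n) * measure M {\<omega> \<in> space M. walk X n \<omega> \<le> x}))"

end

theory Submission
  imports Defs
begin

text \<open>The function \<open>V\<close> is the least nonnegative solution of the renewal equation
  \<open>V(x) = 1{x \<ge> 0} + e\<^sup>a E V(x - T)\<close>, so finiteness follows from any finite supersolution and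
  infiniteness from showing that no finite one exists. If \<open>e\<^sup>a \<psi>(t) < 1\<close>, a multiple of \<open>e\<^sup>t\<^sup>x\<close> is a
  supersolution. In the critical case the change of measure \<open>e\<^sup>a e\<^bsup>-\<gamma>T\<^esup>\<close> with \<open>\<gamma> = \<gamma>\<^sub>0\<close> turns the
  equation into one for a probability law: with positive drift, hitting probabilities of a
  half-line give a bounded supersolution with a source on an interval, and shifted copies of it
  are summed; with zero drift no bounded supersolution with a source exists. For \<open>a > R\<close> the step is
  truncated so that the minimiser of the truncated transform makes the drift zero
  (or nonpositive, if the minimiser is 0).\<close>

subsection \<open>Bounded supersolutions for centred and for drifting steps\<close>

text \<open>The obstacle for a > R is that \<psi> may be infinite to the right of \<gamma>0. The
  tilted mean there can then be strictly positive, as in (ii), so tilting T itself need not give a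
  centred step. A truncated transform is differentiable everywhere, so its interior minimisers do
  give one. The lost mass is affordable: inf \<psi> > e^(-a) leaves room, and by compactness some
  cut-off keeps the truncated infimum above e^(-a). At a = R there is no room, so the untruncated
  tilted law must be used, of which only a first moment is known. This shapes both lemmas on bounded
  supersolutions: the remainder for centred steps may grow only linearly in the step, and the
  argument for positive drift uses neither a variance nor a law of large numbers. After tilting, the
  source 1{x \<ge> 0} becomes e^(-\<gamma> x) on [0, \<infinity>). Since a > 0 forces \<gamma>0 > 0,
  it decays geometrically from one interval of fixed length to the next, so the shifted copies can
  be summed.\<close>

lemma (in prob_space) prob_ge_pos:
  assumes [measurable]: "Y \<in> borel_measurable M" and pos: "prob {\<omega> \<in> space M. Y \<omega> > (0::real)} > 0"
  obtains e where "e > 0" "prob {\<omega> \<in> space M. Y \<omega> \<ge> e} > 0"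
proof -
  have "\<exists>n::nat. prob {\<omega> \<in> space M. Y \<omega> \<ge> inverse (real (Suc n))} > 0"
  proof (rule ccontr)
    assume "\<not> ?thesis"
    then have "prob {\<omega> \<in> space M. Y \<omega> \<ge> inverse (real (Suc n))} = 0" for n
      using measure_nonneg[of M "{\<omega> \<in> space M. Y \<omega> \<ge> inverse (real (Suc n))}"]
      by (auto simp: not_less intro: antisym)
    then have "AE \<omega> in M. \<not> Y \<omega> \<ge> inverse (real (Suc n))" for n
      by (subst (asm) prob_eq_0) auto
    then have "AE \<omega> in M. \<forall>n. \<not> Y \<omega> \<ge> inverse (real (Suc n))"
      by (subst AE_all_countable) auto
    then have "AE \<omega> in M. \<not> Y \<omega> > 0"
      by eventually_elim (meson less_imp_le reals_Archimedean)
    then have "prob {\<omega> \<in> space M. Y \<omega> > 0} = 0" by (subst prob_eq_0) auto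
    then show False using pos by simp
  qed
  then obtain n :: nat where "prob {\<omega> \<in> space M. Y \<omega> \<ge> inverse (real (Suc n))} > 0" by blast
  then show thesis by (intro that[of "inverse (real (Suc n))"]) simp_all
qed

lemma (in prob_space) prob_space_density_weight:
  fixes \<rho> :: "'a \<Rightarrow> real"
  assumes "integrable M \<rho>" "\<And>\<omega>. 0 \<le> \<rho> \<omega>" "(\<integral>\<omega>. \<rho> \<omega> \<partial>M) = 1"
  shows "prob_space (density M (\<lambda>\<omega>. ennreal (\<rho> \<omega>)))"
proof
  have [measurable]: "\<rho> \<in> borel_measurable M" using assms by auto
  show "emeasure (density M (\<lambda>\<omega>. ennreal (\<rho> \<omega>))) (space (density M (\<lambda>\<omega>. ennreal (\<rho> \<omega>)))) = 1"
    using assms by (subst emeasure_density) (auto simp: nn_integral_eq_integral cong: nn_integral_cong)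
qed

section \<open>A test kernel for centred steps\<close>

definition cauchy_kernel :: "real \<Rightarrow> real" where
  "cauchy_kernel x = 1 / (1 + x\<^sup>2)"

definition cauchy_kernel' :: "real \<Rightarrow> real" where
  "cauchy_kernel' x = - 2 * x / (1 + x\<^sup>2)\<^sup>2"

lemma cauchy_kernel_measurable [measurable]:
  "cauchy_kernel \<in> borel_measurable borel" "cauchy_kernel' \<in> borel_measurable borel"
  unfolding cauchy_kernel_def[abs_def] cauchy_kernel'_def[abs_def] by measurable

lemma cauchy_kernel_pos: "cauchy_kernel x > 0"
  by (simp add: cauchy_kernel_def add_pos_nonneg)

lemma abs_cauchy_kernel'_le: "\<bar>cauchy_kernel' x\<bar> \<le> cauchy_kernel x"
proof -
  have p: "1 + x\<^sup>2 > 0" by (simp add: add_pos_nonneg)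
  have "0 \<le> (1 - \<bar>x\<bar>)\<^sup>2" by simp
  then have "2 * \<bar>x\<bar> \<le> 1 + x\<^sup>2" by (simp add: power2_eq_square algebra_simps)
  then have "2 * \<bar>x\<bar> / (1 + x\<^sup>2) \<le> 1" using p by simp
  moreover have "\<bar>cauchy_kernel' x\<bar> = 2 * \<bar>x\<bar> / (1 + x\<^sup>2) * cauchy_kernel x"
    by (simp add: cauchy_kernel'_def cauchy_kernel_def abs_mult power2_eq_square)
  ultimately show ?thesis
    using cauchy_kernel_pos[of x] mult_right_mono[of "2 * \<bar>x\<bar> / (1 + x\<^sup>2)" 1 "cauchy_kernel x"] by simp
qed

lemma integrable_cauchy_kernel: "integrable lborel cauchy_kernel"
  using integrable_inverse_1_plus_square
  by (simp add: set_integrable_def cauchy_kernel_def[abs_def] inverse_eq_divide)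

text \<open>Only an upper bound is claimed, and it is a multiple of the kernel itself, hence
  integrable in x. For large y the positive term \<open>cauchy_kernel (x + y)\<close> is dropped and
  the derivative is bounded by the kernel; for |y| \<le> 1 one clears denominators. The linear
  growth for large y suits a step with only a first moment, while the quadratic behaviour near 0
  makes the rescaled remainder vanish faster than the source.\<close>

lemma cauchy_kernel_second_order:
  "cauchy_kernel x - cauchy_kernel (x + y) + y * cauchy_kernel' x
    \<le> 2 * min (y\<^sup>2) \<bar>y\<bar> * cauchy_kernel x"
proof (cases "\<bar>y\<bar> \<le> 1")
  case True
  define p where "p = 1 + x\<^sup>2"
  define q where "q = 1 + (x + y)\<^sup>2"
  have pq: "p \<ge> 1" "q \<ge> 1" by (auto simp: p_def q_def)
  have "cauchy_kernel x - cauchy_kernel (x + y) + y * cauchy_kernel' x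
      = (p * q - p\<^sup>2 - 2 * x * y * q) / (p\<^sup>2 * q)"
    using pq unfolding cauchy_kernel_def cauchy_kernel'_def p_def[symmetric] q_def[symmetric]
    by (simp add: field_simps power2_eq_square)
  also have "p * q - p\<^sup>2 - 2 * x * y * q = y\<^sup>2 * (1 - 3 * x\<^sup>2 - 2 * x * y)"
    unfolding p_def q_def by algebra
  also have "1 - 3 * x\<^sup>2 - 2 * x * y = (1 + y\<^sup>2) - 2 * x\<^sup>2 - (x + y)\<^sup>2"
    by algebra
  also have "y\<^sup>2 * ((1 + y\<^sup>2) - 2 * x\<^sup>2 - (x + y)\<^sup>2) / (p\<^sup>2 * q) \<le> y\<^sup>2 * 2 / (p\<^sup>2 * q)"
  proof -
    have "y\<^sup>2 \<le> 1" using True by (simp add: abs_square_le_1)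
    then have "(1 + y\<^sup>2) - 2 * x\<^sup>2 - (x + y)\<^sup>2 \<le> 2" by (smt (verit) zero_le_power2)
    then show ?thesis using pq by (intro divide_right_mono mult_left_mono) auto
  qed
  also have "\<dots> \<le> y\<^sup>2 * 2 / p"
  proof -
    have "p * 1 \<le> p * (p * q)"
      using pq by (intro mult_left_mono) (auto simp: mult_ge1_I)
    then show ?thesis using pq by (intro divide_left_mono) (auto simp: power2_eq_square mult_ac)
  qed
  also have "y\<^sup>2 * 2 / p = 2 * y\<^sup>2 * cauchy_kernel x"
    by (simp add: cauchy_kernel_def p_def)
  also have "y\<^sup>2 = min (y\<^sup>2) \<bar>y\<bar>"
    using True mult_left_le[of "\<bar>y\<bar>" "\<bar>y\<bar>"] by (simp add: min_def power2_eq_square flip: abs_mult)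
  finally show ?thesis by (simp add: mult_ac)
next
  case False
  have "y * cauchy_kernel' x \<le> \<bar>y\<bar> * \<bar>cauchy_kernel' x\<bar>"
    by (metis abs_ge_self abs_mult)
  also have "\<dots> \<le> \<bar>y\<bar> * cauchy_kernel x"
    by (intro mult_left_mono abs_cauchy_kernel'_le) auto
  finally have "cauchy_kernel x - cauchy_kernel (x + y) + y * cauchy_kernel' x
      \<le> cauchy_kernel x + \<bar>y\<bar> * cauchy_kernel x"
    using cauchy_kernel_pos[of "x + y"] by simp
  also have "\<dots> \<le> \<bar>y\<bar> * cauchy_kernel x + \<bar>y\<bar> * cauchy_kernel x"
    using False cauchy_kernel_pos[of x] by simp
  also have "\<dots> = 2 * min (y\<^sup>2) \<bar>y\<bar> * cauchy_kernel x"
  proof -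
    have "\<bar>y\<bar> * 1 \<le> \<bar>y\<bar> * \<bar>y\<bar>" using False by (intro mult_left_mono) auto
    then have "\<bar>y\<bar> \<le> y\<^sup>2" by (simp add: power2_eq_square)
    then show ?thesis by (simp add: min_def)
  qed
  finally show ?thesis .
qed

text \<open>Pairing the inequality, rescaled by a large factor \<open>A\<close>, with \<open>1 / (1 + x\<^sup>2)\<close> moves the
  convolution onto that kernel, where the first-order term vanishes because \<open>Y\<close> is centred.
  The source contributes order \<open>1 / A\<close>, the remainder only \<open>o(1 / A)\<close>.\<close>

lemma (in prob_space) centred_bounded_supersolution_trivial:
  fixes Y :: "'a \<Rightarrow> real" and w :: "real \<Rightarrow> real"
  assumes Y: "integrable M Y" "(\<integral>\<omega>. Y \<omega> \<partial>M) = 0"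
    and w [measurable]: "w \<in> borel_measurable borel"
    and bounds: "\<And>x. 0 \<le> w x" "\<And>x. w x \<le> c"
    and "s > 0" "d > 0"
    and super: "\<And>x. ennreal (s * indicator {0..<d} x) + (\<integral>\<^sup>+ \<omega>. ennreal (w (x - Y \<omega>)) \<partial>M) \<le> ennreal (w x)"
  shows False
proof -
  let ?f = cauchy_kernel
  define K where "K = (\<integral>x. ?f x \<partial>lborel)"
  have [measurable]: "Y \<in> borel_measurable M" using Y by auto
  have c: "c \<ge> 0" using bounds[of 0] by simp
  \<comment> \<open>For A \<ge> d the rescaled source interval [0, d/A) lies in [0, 1], where the
    kernel is at least 1/2; this gives the left-hand constant.\<close>
  have key: "s * d / 2 \<le> 2 * c * K * (\<integral>\<omega>. min ((Y \<omega>)\<^sup>2 / A) \<bar>Y \<omega>\<bar> \<partial>M)" if A: "A \<ge> d" for A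
  proof -
    have A0: "A > 0" using A \<open>d > 0\<close> by simp
    \<comment> \<open>Substituting x + Y/A for x turns the pairing of the kernel with w (A x - Y)
      into \<open>\<Psi>\<close> (Y/A). \<open>D\<close> acts as the derivative of
      \<open>\<Psi>\<close> at 0; it enters only multiplied by the mean of Y, which is 0.\<close>
    define \<Psi> where "\<Psi> y = (\<integral>x. ?f (x + y) * w (A * x) \<partial>lborel)" for y
    define D where "D = (\<integral>x. cauchy_kernel' x * w (A * x) \<partial>lborel)"
    have int_shift: "integrable lborel (\<lambda>x. ?f (x + y))" for y
      using integrable_cauchy_kernel lborel_integrable_real_affine[of ?f 1 y]
      by (simp add: add.commute)
    have int: "integrable lborel (\<lambda>x. ?f (x + y) * w (A * x))" for y
      by (rule Bochner_Integration.integrable_bound[OF integrable_mult_left[where c = c, OF int_shift[of y]]])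
         (use bounds c cauchy_kernel_pos in \<open>auto simp: abs_mult less_imp_le intro!: mult_left_mono\<close>)
    have int0: "integrable lborel (\<lambda>x. ?f x * w (A * x))"
      using int[of 0] by simp
    have intD: "integrable lborel (\<lambda>x. cauchy_kernel' x * w (A * x))"
      by (rule Bochner_Integration.integrable_bound[OF integrable_mult_left[where c = c, OF integrable_cauchy_kernel]])
         (use bounds c abs_cauchy_kernel'_le cauchy_kernel_pos
            in \<open>auto simp: abs_mult less_imp_le intro!: mult_mono\<close>)
    have nn: "(\<integral>\<^sup>+ x. ennreal (?f (x + y)) * ennreal (w (A * x)) \<partial>lborel) = ennreal (\<Psi> y)" for y
      unfolding \<Psi>_def
      by (subst nn_integral_eq_integral[OF int, symmetric])
         (use bounds cauchy_kernel_pos in \<open>auto simp: ennreal_mult less_imp_le intro!: nn_integral_cong\<close>)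
    have \<Psi>_bounds: "0 \<le> \<Psi> y" "\<Psi> y \<le> c * K" for y
    proof -
      show "0 \<le> \<Psi> y" unfolding \<Psi>_def
        by (intro integral_nonneg_AE) (use bounds cauchy_kernel_pos in \<open>auto simp: less_imp_le\<close>)
      have "\<Psi> y \<le> (\<integral>x. ?f (x + y) * c \<partial>lborel)" unfolding \<Psi>_def
        by (intro integral_mono int integrable_mult_left int_shift)
           (use bounds cauchy_kernel_pos in \<open>auto simp: less_imp_le intro!: mult_left_mono\<close>)
      also have "\<dots> = c * K"
        using lborel_integral_real_affine[of 1 ?f y] by (simp add: K_def add.commute)
      finally show "\<Psi> y \<le> c * K" .
    qed
    have \<Psi>_meas [measurable]: "\<Psi> \<in> borel_measurable borel"
      unfolding \<Psi>_def by measurable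
    have \<Psi>_le: "\<Psi> 0 - \<Psi> y + y * D \<le> 2 * c * K * min (y\<^sup>2) \<bar>y\<bar>" for y
    proof -
      have "\<Psi> 0 - \<Psi> y + y * D =
          (\<integral>x. (?f x - ?f (x + y) + y * cauchy_kernel' x) * w (A * x) \<partial>lborel)"
        unfolding \<Psi>_def D_def using int0 int[of y] intD
        by (simp add: algebra_simps)
      also have "\<dots> \<le> (\<integral>x. (2 * min (y\<^sup>2) \<bar>y\<bar> * c) * ?f x \<partial>lborel)"
      proof (rule integral_mono)
        show "integrable lborel (\<lambda>x. (?f x - ?f (x + y) + y * cauchy_kernel' x) * w (A * x))"
          using int0 int[of y] intD by (simp add: algebra_simps)
        show "integrable lborel (\<lambda>x. (2 * min (y\<^sup>2) \<bar>y\<bar> * c) * ?f x)"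
          by (intro integrable_mult_right integrable_cauchy_kernel)
        show "(?f x - ?f (x + y) + y * cauchy_kernel' x) * w (A * x) \<le> (2 * min (y\<^sup>2) \<bar>y\<bar> * c) * ?f x" for x
        proof -
          have "(?f x - ?f (x + y) + y * cauchy_kernel' x) * w (A * x)
              \<le> (2 * min (y\<^sup>2) \<bar>y\<bar> * ?f x) * w (A * x)"
            by (intro mult_right_mono cauchy_kernel_second_order bounds)
          also have "\<dots> \<le> (2 * min (y\<^sup>2) \<bar>y\<bar> * ?f x) * c"
            using cauchy_kernel_pos[of x] by (intro mult_left_mono bounds) auto
          finally show ?thesis by (simp add: mult_ac)
        qed
      qed
      also have "\<dots> = 2 * c * K * min (y\<^sup>2) \<bar>y\<bar>"
        by (simp add: K_def mult_ac)
      finally show ?thesis .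
    qed
    have int_\<Psi>: "integrable M (\<lambda>\<omega>. \<Psi> (Y \<omega> / A))"
      by (rule integrable_const_bound[of _ "c * K"]) (use \<Psi>_bounds in auto)
    \<comment> \<open>Pulling out 1/A exposes the order of the source term. The remaining factor is
      dominated by |Y| and tends to 0 pointwise as A grows, so its mean tends to 0 as well.\<close>
    have min_A: "min ((y / A)\<^sup>2) \<bar>y / A\<bar> = min (y\<^sup>2 / A) \<bar>y\<bar> / A" for y
      using A0 by (simp add: min_def field_simps power2_eq_square)
    have int_min: "integrable M (\<lambda>\<omega>. min ((Y \<omega>)\<^sup>2 / A) \<bar>Y \<omega>\<bar>)"
      by (rule Bochner_Integration.integrable_bound[OF integrable_abs[OF Y(1)]])
         (use A0 in auto)
    have "(\<integral>\<^sup>+ x. ennreal (s / 2) * indicator {0..<d / A} x \<partial>lborel) + ennreal (\<integral>\<omega>. \<Psi> (Y \<omega> / A) \<partial>M)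
        \<le> (\<integral>\<^sup>+ x. ennreal (?f x) * ennreal (s * indicator {0..<d} (A * x)) \<partial>lborel)
         + (\<integral>\<^sup>+ x. ennreal (?f x) * (\<integral>\<^sup>+ \<omega>. ennreal (w (A * x - Y \<omega>)) \<partial>M) \<partial>lborel)"
    proof (rule add_mono)
      have "1 / 2 \<le> ?f x" if "x \<in> {0..<d/A}" for x
      proof -
        have "d / A \<le> 1" using A A0 by simp
        then have "x\<^sup>2 \<le> 1" using that by (auto simp: power_le_one_iff abs_square_le_1)
        then show ?thesis by (simp add: cauchy_kernel_def field_simps add_pos_nonneg)
      qed
      then have "ennreal (s / 2) * indicator {0..<d / A} x
          \<le> ennreal (?f x) * ennreal (s * indicator {0..<d} (A * x))" for x
        using A0 \<open>s > 0\<close> cauchy_kernel_pos[of x]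
        by (auto simp: indicator_def field_simps simp flip: ennreal_mult intro!: ennreal_leI)
      then show "(\<integral>\<^sup>+ x. ennreal (s / 2) * indicator {0..<d / A} x \<partial>lborel)
        \<le> (\<integral>\<^sup>+ x. ennreal (?f x) * ennreal (s * indicator {0..<d} (A * x)) \<partial>lborel)"
        by (rule nn_integral_mono)
      have "ennreal (\<integral>\<omega>. \<Psi> (Y \<omega> / A) \<partial>M) = (\<integral>\<^sup>+ \<omega>. ennreal (\<Psi> (Y \<omega> / A)) \<partial>M)"
        using \<Psi>_bounds by (intro nn_integral_eq_integral[symmetric] int_\<Psi>) auto
      also have "\<dots> = (\<integral>\<^sup>+ \<omega>. \<integral>\<^sup>+ x. ennreal (?f x) * ennreal (w (A * x - Y \<omega>)) \<partial>lborel \<partial>M)"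
      proof (intro nn_integral_cong)
        fix \<omega>
        have "(\<integral>\<^sup>+ x. ennreal (?f x) * ennreal (w (A * x - Y \<omega>)) \<partial>lborel)
           = (\<integral>\<^sup>+ x. ennreal (?f (Y \<omega> / A + 1 * x)) * ennreal (w (A * (Y \<omega> / A + 1 * x) - Y \<omega>)) \<partial>lborel)"
          by (subst nn_integral_real_affine[where c = 1 and t = "Y \<omega> / A"]) auto
        also have "\<dots> = ennreal (\<Psi> (Y \<omega> / A))"
          unfolding nn[symmetric] using A0
          by (intro nn_integral_cong) (simp add: field_simps add.commute)
        finally show "ennreal (\<Psi> (Y \<omega> / A)) =
          (\<integral>\<^sup>+ x. ennreal (?f x) * ennreal (w (A * x - Y \<omega>)) \<partial>lborel)" by simp
      qed
      also have "\<dots> = (\<integral>\<^sup>+ x. \<integral>\<^sup>+ \<omega>. ennreal (?f x) * ennreal (w (A * x - Y \<omega>)) \<partial>M \<partial>lborel)"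
      proof -
        interpret pair_sigma_finite M lborel ..
        show ?thesis by (rule Fubini'[symmetric]) measurable
      qed
      also have "\<dots> = (\<integral>\<^sup>+ x. ennreal (?f x) * (\<integral>\<^sup>+ \<omega>. ennreal (w (A * x - Y \<omega>)) \<partial>M) \<partial>lborel)"
        by (intro nn_integral_cong nn_integral_cmult) measurable
      finally show "ennreal (\<integral>\<omega>. \<Psi> (Y \<omega> / A) \<partial>M)
        \<le> (\<integral>\<^sup>+ x. ennreal (?f x) * (\<integral>\<^sup>+ \<omega>. ennreal (w (A * x - Y \<omega>)) \<partial>M) \<partial>lborel)" by simp
    qed
    also have "\<dots> = (\<integral>\<^sup>+ x. ennreal (?f x) * (ennreal (s * indicator {0..<d} (A * x))
        + (\<integral>\<^sup>+ \<omega>. ennreal (w (A * x - Y \<omega>)) \<partial>M)) \<partial>lborel)"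
      by (subst nn_integral_add[symmetric]) (auto simp: distrib_left)
    also have "\<dots> \<le> (\<integral>\<^sup>+ x. ennreal (?f x) * ennreal (w (A * x)) \<partial>lborel)"
      by (intro nn_integral_mono mult_left_mono super) auto
    also have "\<dots> = ennreal (\<Psi> 0)"
      using nn[of 0] by simp
    finally have "ennreal (s / 2) * ennreal (d / A) + ennreal (\<integral>\<omega>. \<Psi> (Y \<omega> / A) \<partial>M) \<le> ennreal (\<Psi> 0)"
      using A0 \<open>d > 0\<close> by (simp add: nn_integral_cmult)
    then have "ennreal (s / 2 * (d / A)) + ennreal (\<integral>\<omega>. \<Psi> (Y \<omega> / A) \<partial>M) \<le> ennreal (\<Psi> 0)"
      using A0 \<open>s > 0\<close> \<open>d > 0\<close> by (subst ennreal_mult) auto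
    moreover have "(\<integral>\<omega>. \<Psi> (Y \<omega> / A) \<partial>M) \<ge> 0"
      using \<Psi>_bounds by (intro integral_nonneg_AE) auto
    ultimately have "s / 2 * (d / A) + (\<integral>\<omega>. \<Psi> (Y \<omega> / A) \<partial>M) \<le> \<Psi> 0"
      using A0 \<open>s > 0\<close> \<open>d > 0\<close> \<Psi>_bounds(1)[of 0]
      by (subst (asm) ennreal_plus[symmetric]) (auto simp del: ennreal_plus)
    then have "s * d / (2 * A) \<le> \<Psi> 0 - (\<integral>\<omega>. \<Psi> (Y \<omega> / A) \<partial>M)" by simp
    also have "\<dots> = (\<integral>\<omega>. \<Psi> 0 - \<Psi> (Y \<omega> / A) + Y \<omega> / A * D \<partial>M)"
      using int_\<Psi> Y by (simp add: prob_space)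
    also have "\<dots> \<le> (\<integral>\<omega>. 2 * c * K * (min ((Y \<omega>)\<^sup>2 / A) \<bar>Y \<omega>\<bar> / A) \<partial>M)"
      using int_\<Psi> Y int_min \<Psi>_le[of "y / A" for y, unfolded min_A]
      by (intro integral_mono) auto
    also have "\<dots> = 2 * c * K * (\<integral>\<omega>. min ((Y \<omega>)\<^sup>2 / A) \<bar>Y \<omega>\<bar> \<partial>M) / A"
      using int_min by simp
    finally show ?thesis using A0 by (simp add: field_simps)
  qed
  have "(\<lambda>n. \<integral>\<omega>. min ((Y \<omega>)\<^sup>2 / real n) \<bar>Y \<omega>\<bar> \<partial>M) \<longlonglongrightarrow> (\<integral>\<omega>. 0 \<partial>M)"
  proof (rule integral_dominated_convergence[where w = "\<lambda>\<omega>. \<bar>Y \<omega>\<bar>"])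
    have "(\<lambda>n. min (y\<^sup>2 / real n) \<bar>y\<bar>) \<longlonglongrightarrow> min 0 \<bar>y\<bar>" for y :: real
      by (intro tendsto_min tendsto_const lim_const_over_n)
    then show "AE \<omega> in M. (\<lambda>n. min ((Y \<omega>)\<^sup>2 / real n) \<bar>Y \<omega>\<bar>) \<longlonglongrightarrow> 0"
      by simp
  qed (use Y in auto)
  then have "(\<lambda>n. 2 * c * K * (\<integral>\<omega>. min ((Y \<omega>)\<^sup>2 / real n) \<bar>Y \<omega>\<bar> \<partial>M)) \<longlonglongrightarrow> 2 * c * K * 0"
    by (intro tendsto_mult tendsto_const) simp
  moreover have "\<forall>\<^sub>F n in sequentially. s * d / 2 \<le> 2 * c * K * (\<integral>\<omega>. min ((Y \<omega>)\<^sup>2 / real n) \<bar>Y \<omega>\<bar> \<partial>M)"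
    using eventually_ge_at_top[of "nat \<lceil>d\<rceil>"]
    by eventually_elim (intro key, linarith)
  ultimately have "s * d / 2 \<le> 0"
    by (intro tendsto_lowerbound) auto
  then show False using mult_pos_pos[OF \<open>s > 0\<close> \<open>d > 0\<close>] by simp
qed

text \<open>In the proof, \<open>Q x\<close> is the probability that the walk started in \<open>x\<close> with steps \<open>-Y\<close> ever enters
  \<open>[0, \<infinity>)\<close>. The integrals \<open>m n\<close> of its finite-horizon versions over the negative half-line
  are nondecreasing, which bounds \<open>B n\<close> by the mean of the negative part of \<open>Y\<close>; if \<open>Q\<close> were
  identically 1, then \<open>B n\<close> would tend to the mean of the positive part.\<close>

lemma (in prob_space) positive_drift_supersolution:
  fixes Y :: "'a \<Rightarrow> real"
  assumes Y: "integrable M Y" "(\<integral>\<omega>. Y \<omega> \<partial>M) > 0"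
  obtains r :: "real \<Rightarrow> real" and \<kappa> d :: real
  where "r \<in> borel_measurable borel" "\<And>x. 0 \<le> r x" "\<And>x. r x \<le> 1" "\<kappa> > 0" "d > 0"
    "\<And>x. ennreal (\<kappa> * indicator {0..<d} x) + (\<integral>\<^sup>+ \<omega>. ennreal (r (x - Y \<omega>)) \<partial>M) \<le> ennreal (r x)"
proof -
  have [measurable]: "Y \<in> borel_measurable M" using Y by auto
  define q :: "nat \<Rightarrow> real \<Rightarrow> ennreal" where
    "q = rec_nat (indicator {0..}) (\<lambda>_ g x. if 0 \<le> x then 1 else \<integral>\<^sup>+ \<omega>. g (x - Y \<omega>) \<partial>M)"
  have q_0: "q 0 = indicator {0..}"
    and q_Suc: "q (Suc n) = (\<lambda>x. if 0 \<le> x then 1 else \<integral>\<^sup>+ \<omega>. q n (x - Y \<omega>) \<partial>M)" for n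
    unfolding q_def by simp_all
  have q_meas [measurable]: "q n \<in> borel_measurable borel" for n
    by (induction n) (simp_all add: q_0 q_Suc)
  have q_pos: "q n x = 1" if "0 \<le> x" for n x
    using that by (cases n) (simp_all add: q_0 q_Suc)
  have q_le_1: "q n x \<le> 1" for n x
  proof (induction n arbitrary: x)
    case (Suc n)
    have "(\<integral>\<^sup>+ \<omega>. q n (x - Y \<omega>) \<partial>M) \<le> (\<integral>\<^sup>+ \<omega>. 1 \<partial>M)"
      by (intro nn_integral_mono Suc)
    then show ?case by (simp add: q_Suc emeasure_space_1)
  qed (simp add: q_0 indicator_def)
  have q_mono: "q n x \<le> q n y" if "x \<le> y" for n x y
    using that
  proof (induction n arbitrary: x y)
    case (Suc n)
    then have "(\<integral>\<^sup>+ \<omega>. q n (x - Y \<omega>) \<partial>M) \<le> (\<integral>\<^sup>+ \<omega>. q n (y - Y \<omega>) \<partial>M)"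
      by (intro nn_integral_mono Suc.IH) auto
    then show ?case using Suc.prems q_le_1[of "Suc n" x] by (auto simp: q_Suc)
  qed (auto simp: q_0 indicator_def)
  have q_Suc_ge: "q n x \<le> q (Suc n) x" for n x
  proof (induction n arbitrary: x)
    case (Suc n)
    have "(\<integral>\<^sup>+ \<omega>. q n (x - Y \<omega>) \<partial>M) \<le> (\<integral>\<^sup>+ \<omega>. q (Suc n) (x - Y \<omega>) \<partial>M)"
      by (intro nn_integral_mono Suc)
    then show ?case by (simp add: fun_cong[OF q_Suc, of _ x])
  qed (auto simp: q_0 q_Suc indicator_def)
  have q_inc: "incseq (\<lambda>n. q n x)" for x
    by (intro incseq_SucI q_Suc_ge)

  \<comment> \<open>These quantities obey a mass balance, \<open>m_Suc\<close>. Averaging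
    \<open>q n\<close> (x - Y) over x < 0 integrates \<open>q n\<close> up to -Y instead of 0: for Y
    < 0 this adds [0, -Y), where \<open>q n\<close> is 1, and for Y > 0 it removes [-Y, 0). The mean
    gain is \<open>E\<close>, the mean loss is \<open>B n\<close>.\<close>
  define m where "m n = (\<integral>\<^sup>+ x. q n x * indicator {..<0} x \<partial>lborel)" for n
  define B where "B n = (\<integral>\<^sup>+ \<omega>. \<integral>\<^sup>+ x. q n x * indicator {- Y \<omega>..<0} x \<partial>lborel \<partial>M)" for n
  define E where "E = (\<integral>\<^sup>+ \<omega>. ennreal (- Y \<omega>) \<partial>M)"
  have Fubini: "(\<integral>\<^sup>+ x. \<integral>\<^sup>+ \<omega>. f (\<omega>, x) \<partial>M \<partial>lborel) = (\<integral>\<^sup>+ \<omega>. \<integral>\<^sup>+ x. f (\<omega>, x) \<partial>lborel \<partial>M)"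
    if "f \<in> borel_measurable (M \<Otimes>\<^sub>M borel)" for f
  proof -
    interpret pair_sigma_finite M lborel ..
    have "f \<in> borel_measurable (M \<Otimes>\<^sub>M lborel)" using that by simp
    then show ?thesis using Fubini[of f] by simp
  qed
  have split: "(\<integral>\<^sup>+ x. q n x * indicator {..<-y} x \<partial>lborel) + (\<integral>\<^sup>+ x. q n x * indicator {-y..<0} x \<partial>lborel)
      = m n + ennreal (- y)" for n y
  proof (cases "y \<ge> 0")
    case True
    have "(\<integral>\<^sup>+ x. q n x * indicator {..<-y} x \<partial>lborel) + (\<integral>\<^sup>+ x. q n x * indicator {-y..<0} x \<partial>lborel)
       = (\<integral>\<^sup>+ x. q n x * indicator {..<-y} x + q n x * indicator {-y..<0} x \<partial>lborel)"
      by (rule nn_integral_add[symmetric]) measurable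
    also have "\<dots> = m n"
      unfolding m_def using True by (intro nn_integral_cong) (auto simp: indicator_def)
    finally show ?thesis using True by (simp add: ennreal_neg)
  next
    case False
    have "(\<integral>\<^sup>+ x. q n x * indicator {..<-y} x \<partial>lborel)
       = (\<integral>\<^sup>+ x. q n x * indicator {..<0} x + indicator {0..<-y} x \<partial>lborel)"
      using False by (intro nn_integral_cong) (auto simp: indicator_def q_pos)
    also have "\<dots> = m n + (\<integral>\<^sup>+ x. indicator {0..<-y} x \<partial>lborel)"
      unfolding m_def by (rule nn_integral_add) measurable
    finally show ?thesis using False by simp
  qed
  have m_Suc: "m (Suc n) + B n = m n + E" for n
  proof -
    have "m (Suc n) = (\<integral>\<^sup>+ x. \<integral>\<^sup>+ \<omega>. q n (x - Y \<omega>) * indicator {..<0} x \<partial>M \<partial>lborel)"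
      unfolding m_def q_Suc
      by (intro nn_integral_cong) (auto simp: indicator_def)
    also have "\<dots> = (\<integral>\<^sup>+ \<omega>. \<integral>\<^sup>+ x. q n (x - Y \<omega>) * indicator {..<0} x \<partial>lborel \<partial>M)"
      using Fubini[of "\<lambda>(\<omega>, x). q n (x - Y \<omega>) * indicator {..<0} x"] by simp
    also have "\<dots> = (\<integral>\<^sup>+ \<omega>. \<integral>\<^sup>+ x. q n x * indicator {..<-Y \<omega>} x \<partial>lborel \<partial>M)"
    proof (rule nn_integral_cong)
      fix \<omega>
      have "(\<integral>\<^sup>+ x. q n (x - Y \<omega>) * indicator {..<0} x \<partial>lborel)
        = (\<integral>\<^sup>+ x. q n ((Y \<omega> + 1 * x) - Y \<omega>) * indicator {..<0} (Y \<omega> + 1 * x) \<partial>lborel)"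
        by (subst nn_integral_real_affine[where c = 1 and t = "Y \<omega>"]) auto
      also have "\<dots> = (\<integral>\<^sup>+ x. q n x * indicator {..<-Y \<omega>} x \<partial>lborel)"
        by (intro nn_integral_cong) (auto simp: indicator_def)
      finally show "(\<integral>\<^sup>+ x. q n (x - Y \<omega>) * indicator {..<0} x \<partial>lborel) = \<dots>" .
    qed
    finally have "m (Suc n) + B n = (\<integral>\<^sup>+ \<omega>. (\<integral>\<^sup>+ x. q n x * indicator {..<-Y \<omega>} x \<partial>lborel)
        + (\<integral>\<^sup>+ x. q n x * indicator {-Y \<omega>..<0} x \<partial>lborel) \<partial>M)"
      unfolding B_def by (subst nn_integral_add) (auto simp: indicator_def)
    also have "\<dots> = m n + E"
      unfolding split E_def by (subst nn_integral_add) (auto simp: emeasure_space_1)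
    finally show ?thesis .
  qed
  have E_fin: "E < \<infinity>"
    using Y(1) unfolding E_def real_integrable_def by (simp add: top.not_eq_extremum)
  \<comment> \<open>Finiteness, inherited from \<open>m 0\<close> = 0, is what allows
    \<open>m n\<close> to be cancelled in the balance.\<close>
  have m_fin: "m n < \<infinity>" for n
  proof (induction n)
    case 0
    have "m 0 = (\<integral>\<^sup>+ x. 0 \<partial>(lborel :: real measure))"
      unfolding m_def q_0 by (intro nn_integral_cong) (auto simp: indicator_def)
    then show ?case by simp
  next
    case (Suc n)
    have "m (Suc n) \<le> m n + E" unfolding m_Suc[symmetric] by simp
    also have "\<dots> < \<infinity>" using Suc E_fin by simp
    finally show ?case .
  qed
  have B_le: "B n \<le> E" for n
  proof -
    have "m n \<le> m (Suc n)"
      unfolding m_def by (intro nn_integral_mono mult_right_mono q_Suc_ge) auto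
    then have "m n + B n \<le> m n + E"
      unfolding m_Suc[symmetric] by (intro add_right_mono)
    then show ?thesis using m_fin[of n] by (auto simp: ennreal_add_left_cancel_le)
  qed

  define Q where "Q x = (SUP n. q n x)" for x
  have Q_le_1: "Q x \<le> 1" for x unfolding Q_def by (intro SUP_least q_le_1)
  have Q_pos: "Q x = 1" if "0 \<le> x" for x using that by (simp add: Q_def q_pos)
  have Q_mono: "Q x \<le> Q y" if "x \<le> y" for x y
    unfolding Q_def by (intro SUP_mono) (use q_mono[OF that] in auto)
  have [measurable]: "Q \<in> borel_measurable borel"
    unfolding Q_def[abs_def] by measurable
  have Q_SUP: "(\<integral>\<^sup>+ \<omega>. Q (x - Y \<omega>) \<partial>M) = (SUP n. \<integral>\<^sup>+ \<omega>. q n (x - Y \<omega>) \<partial>M)" for x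
    unfolding Q_def
    by (rule nn_integral_monotone_convergence_SUP) (auto simp: incseq_def le_fun_def q_inc[THEN incseqD])
  have Q_eq: "Q x = (\<integral>\<^sup>+ \<omega>. Q (x - Y \<omega>) \<partial>M)" if "x < 0" for x
  proof (rule antisym)
    have q_Suc': "q (Suc n) x = (\<integral>\<^sup>+ \<omega>. q n (x - Y \<omega>) \<partial>M)" for n
      using that by (simp add: q_Suc)
    show "Q x \<le> (\<integral>\<^sup>+ \<omega>. Q (x - Y \<omega>) \<partial>M)"
      unfolding Q_SUP unfolding Q_def q_Suc'[symmetric]
      by (intro SUP_mono) (use q_Suc_ge in auto)
    show "(\<integral>\<^sup>+ \<omega>. Q (x - Y \<omega>) \<partial>M) \<le> Q x"
      unfolding Q_SUP unfolding Q_def q_Suc'[symmetric] by (intro SUP_mono) auto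
  qed
  have Q_not_1: "\<exists>x. Q x \<noteq> 1"
  proof (rule ccontr)
    assume "\<not> ?thesis"
    then have Q1: "Q x = 1" for x by auto
    have "(SUP n. B n) = (\<integral>\<^sup>+ \<omega>. (SUP n. \<integral>\<^sup>+ x. q n x * indicator {- Y \<omega>..<0} x \<partial>lborel) \<partial>M)"
      unfolding B_def
      by (rule nn_integral_monotone_convergence_SUP[symmetric])
         (auto simp: incseq_def le_fun_def indicator_def intro!: nn_integral_mono q_inc[THEN incseqD])
    also have "\<dots> = (\<integral>\<^sup>+ \<omega>. ennreal (Y \<omega>) \<partial>M)"
    proof (rule nn_integral_cong)
      fix \<omega>
      have "(SUP n. \<integral>\<^sup>+ x. q n x * indicator {- Y \<omega>..<0} x \<partial>lborel)
        = (\<integral>\<^sup>+ x. (SUP n. q n x * indicator {- Y \<omega>..<0} x) \<partial>lborel)"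
        by (rule nn_integral_monotone_convergence_SUP[symmetric])
           (auto simp: incseq_def le_fun_def indicator_def q_inc[THEN incseqD])
      also have "\<dots> = (\<integral>\<^sup>+ x. indicator {- Y \<omega>..<0} x \<partial>lborel)"
        using Q1 by (intro nn_integral_cong) (auto simp: indicator_def Q_def)
      also have "\<dots> = ennreal (Y \<omega>)"
        by (cases "Y \<omega> \<ge> 0") (auto simp: ennreal_neg)
      finally show "(SUP n. \<integral>\<^sup>+ x. q n x * indicator {- Y \<omega>..<0} x \<partial>lborel) = ennreal (Y \<omega>)" .
    qed
    finally have "(\<integral>\<^sup>+ \<omega>. ennreal (Y \<omega>) \<partial>M) \<le> E"
      using SUP_least[of UNIV B E] B_le by simp
    then have "enn2real (\<integral>\<^sup>+ \<omega>. ennreal (Y \<omega>) \<partial>M) \<le> enn2real E"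
      using E_fin by (intro enn2real_mono) auto
    then show False
      using Y(2) unfolding real_lebesgue_integral_def[OF Y(1)] E_def by simp
  qed

  have "prob {\<omega> \<in> space M. Y \<omega> > 0} > 0"
  proof (rule ccontr)
    assume "\<not> ?thesis"
    then have "prob {\<omega> \<in> space M. Y \<omega> > 0} = 0"
      using measure_nonneg[of M "{\<omega> \<in> space M. Y \<omega> > 0}"] by linarith
    then have "AE \<omega> in M. Y \<omega> \<le> 0" by (subst (asm) prob_eq_0) (auto simp: not_less)
    then have "(\<integral>\<omega>. Y \<omega> \<partial>M) \<le> (\<integral>\<omega>. 0 \<partial>M)"
      using Y by (intro integral_mono_AE) auto
    then show False using Y by simp
  qed
  then obtain e where e: "e > 0" "prob {\<omega> \<in> space M. Y \<omega> \<ge> e} > 0"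
    using prob_ge_pos[of Y] by auto
  \<comment> \<open>Halving leaves a margin: from x < d, a step with Y \<ge> 2d leads below -d,
    where the hitting probability is at most r (-d). Once r (-d) < 1 is known, this deficit has
    probability at least p and yields the source p (1 - r (-d)) on [0, d).\<close>
  define d where "d = e / 2"
  define p where "p = prob {\<omega> \<in> space M. Y \<omega> \<ge> 2 * d}"
  have d: "d > 0" and p: "p > 0" using e by (simp_all add: d_def p_def)

  define r where "r x = enn2real (Q x)" for x
  have Q_r: "Q x = ennreal (r x)" for x
    unfolding r_def using Q_le_1[of x] by (simp add: ennreal_enn2real_if less_le_trans[of _ 1 top] top.not_eq_extremum le_less_trans[of _ 1 top])
  have r_nonneg: "0 \<le> r x" for x by (simp add: r_def)
  have r_le_1: "r x \<le> 1" for x using Q_le_1[of x] Q_r[of x] by (simp)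
  have r_mono: "r x \<le> r y" if "x \<le> y" for x y
    using Q_mono[OF that] r_nonneg by (simp add: Q_r)
  have r_meas [measurable]: "r \<in> borel_measurable borel" unfolding r_def[abs_def] by measurable
  \<comment> \<open>With probability p the next value is at most r (x - 2d), by monotonicity, and
    otherwise it is at most 1.\<close>
  have step: "ennreal (p * (1 - r (x - 2 * d))) + (\<integral>\<^sup>+ \<omega>. Q (x - Y \<omega>) \<partial>M) \<le> 1" for x
  proof -
    have "ennreal (p * (1 - r (x - 2 * d)))
      = (\<integral>\<^sup>+ \<omega>. ennreal (1 - r (x - 2 * d)) * indicator {\<omega> \<in> space M. Y \<omega> \<ge> 2 * d} \<omega> \<partial>M)"
      using r_le_1 unfolding p_def
      by (subst nn_integral_cmult_indicator) (auto simp: emeasure_eq_measure ennreal_mult' mult.commute)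
    then have "ennreal (p * (1 - r (x - 2 * d))) + (\<integral>\<^sup>+ \<omega>. Q (x - Y \<omega>) \<partial>M)
      = (\<integral>\<^sup>+ \<omega>. ennreal (1 - r (x - 2 * d)) * indicator {\<omega> \<in> space M. Y \<omega> \<ge> 2 * d} \<omega> + Q (x - Y \<omega>) \<partial>M)"
      by (subst nn_integral_add) auto
    also have "\<dots> \<le> (\<integral>\<^sup>+ \<omega>. 1 \<partial>M)"
    proof (rule nn_integral_mono)
      fix \<omega>
      show "ennreal (1 - r (x - 2 * d)) * indicator {\<omega> \<in> space M. Y \<omega> \<ge> 2 * d} \<omega> + Q (x - Y \<omega>) \<le> 1"
      proof (cases "\<omega> \<in> space M \<and> Y \<omega> \<ge> 2 * d")
        case True
        then have "ennreal (1 - r (x - 2 * d)) + ennreal (r (x - Y \<omega>)) \<le> ennreal 1"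
          using r_mono[of "x - Y \<omega>" "x - 2 * d"] r_le_1[of "x - 2 * d"] r_nonneg[of "x - Y \<omega>"]
          by (subst ennreal_plus[symmetric]) (auto simp del: ennreal_plus ennreal_1 intro!: ennreal_leI)
        then show ?thesis using True by (simp add: Q_r)
      qed (use Q_le_1 in auto)
    qed
    finally show ?thesis by (simp add: emeasure_space_1)
  qed
  \<comment> \<open>On the negative half-line \<open>Q\<close> equals its own average, so the value
    1 at x forces the value 1 at x - 2d by \<open>step\<close>. Iterating from -d would make
    \<open>Q\<close> identically 1.\<close>
  have r_neg: "r (- d) < 1"
  proof (rule ccontr)
    assume "\<not> ?thesis"
    then have r1: "r (- d) = 1" using r_le_1[of "-d"] by simp
    have r_iter: "r (- d - real k * (2 * d)) = 1" for k
    proof (induction k)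
      case (Suc k)
      let ?x = "- d - real k * (2 * d)"
      have "0 \<le> real k * (2 * d)" using d by simp
      then have "?x < 0" using d by linarith
      then have "ennreal (p * (1 - r (?x - 2 * d))) + 1 \<le> 1"
        using step[of ?x] Q_eq[of ?x] Suc by (simp add: Q_r)
      then have "ennreal (p * (1 - r (?x - 2 * d))) = 0"
        using ennreal_add_left_cancel_le[of 1 "ennreal (p * (1 - r (?x - 2 * d)))" 0]
        by (simp add: add.commute)
      then have "p * (1 - r (?x - 2 * d)) \<le> 0"
        by (simp add: ennreal_eq_0_iff del: mult_le_0_iff)
      then have "r (?x - 2 * d) = 1"
        using p r_le_1[of "?x - 2 * d"] by (simp add: mult_le_0_iff)
      then show ?case by (simp add: algebra_simps)
    qed (simp add: r1)
    have "r x = 1" for x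
    proof -
      obtain k :: nat where "- x / (2 * d) \<le> real k" using real_arch_simple by blast
      then have "- d - real k * (2 * d) \<le> x" using d by (simp add: field_simps)
      from r_mono[OF this] show ?thesis using r_iter[of k] r_le_1[of x] by simp
    qed
    then show False using Q_not_1 by (simp add: Q_r)
  qed
  have "ennreal (p * (1 - r (- d)) * indicator {0..<d} x) + (\<integral>\<^sup>+ \<omega>. ennreal (r (x - Y \<omega>)) \<partial>M)
      \<le> ennreal (r x)" for x
  proof (cases "x < 0")
    case True
    then show ?thesis using Q_eq[of x] by (simp add: Q_r)
  next
    case False
    have "ennreal (p * (1 - r (- d)) * indicator {0..<d} x) \<le> ennreal (p * (1 - r (x - 2 * d)))"
      using p r_le_1[of "x - 2 * d"] r_mono[of "x - 2 * d" "- d"] by (intro ennreal_leI) (auto simp: indicator_def)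
    then have "ennreal (p * (1 - r (- d)) * indicator {0..<d} x) + (\<integral>\<^sup>+ \<omega>. ennreal (r (x - Y \<omega>)) \<partial>M) \<le> 1"
      using step[of x] unfolding Q_r by (meson add_right_mono order_trans)
    then show ?thesis using False Q_pos[of x] by (simp add: Q_r)
  qed
  moreover have "p * (1 - r (- d)) > 0" using p r_neg by simp
  ultimately show thesis using that[of r "p * (1 - r (- d))" d] r_meas r_nonneg r_le_1 d by blast
qed

subsection \<open>The Laplace transform and its minimiser\<close>

lemma exp_trunc_le:
  "indicator {-b..b} y * exp (- t * y) \<le> exp (\<bar>t\<bar> * b)" for b t y :: real
proof -
  have "- t * y \<le> \<bar>t\<bar> * b" if "\<bar>y\<bar> \<le> b"
    using abs_ge_self[of "- t * y"] mult_left_mono[OF that, of "\<bar>t\<bar>"] by (simp add: abs_mult)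
  then show ?thesis by (auto simp: indicator_def)
qed

lemma exp_second_order: "\<bar>exp x - 1 - x\<bar> \<le> x\<^sup>2 * exp \<bar>x\<bar>" for x :: real
proof -
  have 1: "1 + x \<le> exp x" by (rule exp_ge_add_one_self)
  have 2: "exp x - 1 \<le> x * exp x"
  proof -
    have "(1 - x) * exp x \<le> exp (- x) * exp x"
      using exp_ge_add_one_self[of "-x"] by (intro mult_right_mono) auto
    then show ?thesis by (simp add: algebra_simps flip: exp_add)
  qed
  have "exp x - 1 - x \<le> x * (exp x - 1)" using 2 by (simp add: algebra_simps)
  also have "\<dots> \<le> x\<^sup>2 * exp \<bar>x\<bar>"
  proof (cases "x \<ge> 0")
    case True
    then show ?thesis using mult_left_mono[OF 2, of x] by (simp add: power2_eq_square mult_ac)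
  next
    case False
    then have "x * (exp x - 1) \<le> x * x" using 1 by (intro mult_left_mono_neg) linarith+
    also have "\<dots> \<le> x\<^sup>2 * exp \<bar>x\<bar>"
      using mult_left_mono[of 1 "exp \<bar>x\<bar>" "x\<^sup>2"] by (simp add: power2_eq_square)
    finally show ?thesis .
  qed
  finally show ?thesis using 1 by linarith
qed

text \<open>By convexity of exp the quotient is nondecreasing in h and stays above its limit y at h
  = 0. Weighted by exp (-g T), with y = T, it is the integrand of (\<psi>(g - h) - \<psi>(g)) /
  h.\<close>

lemma exp_quotient_bounds:
  fixes y :: real
  assumes "0 < h" "h \<le> g"
  shows "y \<le> (exp (h * y) - 1) / h" "(exp (h * y) - 1) / h \<le> (exp (g * y) - 1) / g"
proof -
  show "y \<le> (exp (h * y) - 1) / h"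
    using exp_ge_add_one_self[of "h * y"] assms by (simp add: field_simps)
  have "exp ((1 - h / g) *\<^sub>R 0 + (h / g) *\<^sub>R (g * y)) \<le> (1 - h / g) * exp 0 + (h / g) * exp (g * y)"
    using assms by (intro convex_onD[OF exp_convex]) auto
  then have "exp (h * y) \<le> 1 - h / g + h / g * exp (g * y)"
    using assms by simp
  then have "exp (h * y) - 1 \<le> h / g * (exp (g * y) - 1)"
    by (simp add: right_diff_distrib)
  from divide_right_mono[OF this, of h] show "(exp (h * y) - 1) / h \<le> (exp (g * y) - 1) / g"
    using assms by simp
qed

lemma exp_quotient_tendsto:
  fixes y :: real
  shows "((\<lambda>h. (exp (h * y) - 1) / h) \<longlongrightarrow> y) (at 0)"
proof -
  have "((\<lambda>h. exp (h * y)) has_real_derivative y) (at 0)"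
    by (auto intro!: derivative_eq_intros)
  then show ?thesis by (simp add: DERIV_def)
qed

section \<open>Truncated transforms and compactness\<close>

locale real_random_variable = prob_space N for N :: "'a measure" +
  fixes T :: "'a \<Rightarrow> real"
  assumes T [measurable]: "T \<in> borel_measurable N"
begin

abbreviation \<psi> :: "real \<Rightarrow> ennreal" where "\<psi> \<equiv> laplace N T"

text \<open>Values of T outside [-b, b] are discarded, not clipped. The law loses mass, but the
  transform is finite and differentiable for every real t and increases to \<psi> as b
  grows.\<close>

definition trunc_laplace :: "real \<Rightarrow> real \<Rightarrow> real" where
  "trunc_laplace b t = (\<integral>\<omega>. indicator {-b..b} (T \<omega>) * exp (- t * T \<omega>) \<partial>N)"

lemma integrable_trunc: "integrable N (\<lambda>\<omega>. indicator {-b..b} (T \<omega>) * exp (- t * T \<omega>))"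
  by (rule integrable_const_bound[of _ "exp (\<bar>t\<bar> * b)"]) (use exp_trunc_le in auto)

lemma integrable_trunc_times:
  "integrable N (\<lambda>\<omega>. indicator {-b..b} (T \<omega>) * exp (- t * T \<omega>) * T \<omega>)"
proof (rule integrable_const_bound[of _ "exp (\<bar>t\<bar> * b) * \<bar>b\<bar>"])
  show "AE \<omega> in N. norm (indicator {-b..b} (T \<omega>) * exp (- t * T \<omega>) * T \<omega>) \<le> exp (\<bar>t\<bar> * b) * \<bar>b\<bar>"
  proof (rule AE_I2)
    fix \<omega>
    show "norm (indicator {-b..b} (T \<omega>) * exp (- t * T \<omega>) * T \<omega>) \<le> exp (\<bar>t\<bar> * b) * \<bar>b\<bar>"
    proof (cases "T \<omega> \<in> {-b..b}")
      case True
      have "norm (indicator {-b..b} (T \<omega>) * exp (- t * T \<omega>) * T \<omega>)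
          = (indicator {-b..b} (T \<omega>) * exp (- t * T \<omega>)) * \<bar>T \<omega>\<bar>"
        by (simp add: abs_mult)
      also have "\<dots> \<le> exp (\<bar>t\<bar> * b) * \<bar>b\<bar>"
        using True by (intro mult_mono exp_trunc_le) auto
      finally show ?thesis .
    qed simp
  qed
qed auto

lemma DERIV_trunc_laplace:
  "DERIV (trunc_laplace b) t :> - (\<integral>\<omega>. indicator {-b..b} (T \<omega>) * exp (- t * T \<omega>) * T \<omega> \<partial>N)"
    (is "DERIV _ _ :> - ?D")
proof -
  \<comment> \<open>On |T| \<le> b with |h| \<le> 1, the weight is at most exp (|t| b), and
    \<open>exp_second_order\<close> at -h T contributes h^2 b^2 exp |b|. For negative b the
    truncation interval is empty.\<close>
  define C where "C = exp (\<bar>t\<bar> * b) * (b\<^sup>2 * exp \<bar>b\<bar>)"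
  have quad: "\<bar>trunc_laplace b (t + h) - trunc_laplace b t + h * ?D\<bar> \<le> C * h\<^sup>2" if h: "\<bar>h\<bar> \<le> 1" for h
  proof -
    let ?g = "\<lambda>\<omega>. indicator {-b..b} (T \<omega>) * exp (- t * T \<omega>) * (exp (- h * T \<omega>) - 1 - (- h * T \<omega>))"
    have eq: "?g \<omega> = indicator {-b..b} (T \<omega>) * exp (- (t + h) * T \<omega>)
        - indicator {-b..b} (T \<omega>) * exp (- t * T \<omega>)
        + h * (indicator {-b..b} (T \<omega>) * exp (- t * T \<omega>) * T \<omega>)" for \<omega>
    proof -
      have "exp (- (t + h) * T \<omega>) = exp (- t * T \<omega>) * exp (- h * T \<omega>)"
        by (simp add: algebra_simps flip: exp_add)
      then show ?thesis by (simp add: algebra_simps)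
    qed
    have "trunc_laplace b (t + h) - trunc_laplace b t + h * ?D = (\<integral>\<omega>. ?g \<omega> \<partial>N)"
      unfolding eq trunc_laplace_def
      using integrable_trunc[of b t] integrable_trunc[of b "t + h"] integrable_trunc_times[of b t]
      by simp
    also have "\<bar>\<dots>\<bar> \<le> (\<integral>\<omega>. C * h\<^sup>2 \<partial>N)"
    proof (rule order_trans[OF integral_abs_bound], rule integral_mono)
      show "integrable N (\<lambda>\<omega>. \<bar>?g \<omega>\<bar>)"
        unfolding eq
        using integrable_trunc[of b t] integrable_trunc[of b "t + h"] integrable_trunc_times[of b t]
        by simp
      show "\<bar>?g \<omega>\<bar> \<le> C * h\<^sup>2" for \<omega>
      proof (cases "T \<omega> \<in> {-b..b}")
        case True
        have "\<bar>- h * T \<omega>\<bar> \<le> 1 * \<bar>b\<bar>"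
          unfolding abs_mult using h True by (intro mult_mono) auto
        moreover have "(- h * T \<omega>)\<^sup>2 \<le> h\<^sup>2 * b\<^sup>2"
          using True by (auto simp: power_mult_distrib intro!: mult_left_mono abs_le_square_iff[THEN iffD1])
        ultimately have "\<bar>exp (- h * T \<omega>) - 1 - (- h * T \<omega>)\<bar> \<le> h\<^sup>2 * b\<^sup>2 * exp \<bar>b\<bar>"
          by (intro order_trans[OF exp_second_order] mult_mono) auto
        then have "(indicator {-b..b} (T \<omega>) * exp (- t * T \<omega>)) * \<bar>exp (- h * T \<omega>) - 1 - (- h * T \<omega>)\<bar>
            \<le> exp (\<bar>t\<bar> * b) * (h\<^sup>2 * b\<^sup>2 * exp \<bar>b\<bar>)"
          by (intro mult_mono exp_trunc_le) auto
        then show ?thesis by (simp add: C_def abs_mult mult_ac)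
      qed (simp add: C_def)
    qed auto
    also have "\<dots> = C * h\<^sup>2" by (simp add: prob_space)
    finally show ?thesis .
  qed
  have "((\<lambda>h. (trunc_laplace b (t + h) - trunc_laplace b t) / h - - ?D) \<longlongrightarrow> 0) (at 0)"
  proof (rule Lim_null_comparison)
    show "((\<lambda>h. C * \<bar>h\<bar>) \<longlongrightarrow> 0) (at 0)"
      by (auto intro!: tendsto_eq_intros)
    have "\<forall>\<^sub>F h in at (0::real). \<bar>h\<bar> < 1 \<and> h \<noteq> 0"
      unfolding eventually_at by (intro exI[of _ 1]) (auto simp: dist_real_def)
    then show "\<forall>\<^sub>F h in at 0. norm ((trunc_laplace b (t + h) - trunc_laplace b t) / h - - ?D) \<le> C * \<bar>h\<bar>"
    proof eventually_elim
      case (elim h)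
      have "(trunc_laplace b (t + h) - trunc_laplace b t) / h - - ?D
          = (trunc_laplace b (t + h) - trunc_laplace b t + h * ?D) / h"
        using elim by (simp add: field_simps)
      then have "norm ((trunc_laplace b (t + h) - trunc_laplace b t) / h - - ?D)
          = \<bar>trunc_laplace b (t + h) - trunc_laplace b t + h * ?D\<bar> / \<bar>h\<bar>"
        by (simp only: real_norm_def abs_divide)
      also have "\<dots> \<le> C * h\<^sup>2 / \<bar>h\<bar>"
        using elim by (intro divide_right_mono quad) auto
      also have "\<dots> = C * \<bar>h\<bar>"
        using elim by (cases "h \<ge> 0") (simp_all add: power2_eq_square)
      finally show ?case .
    qed
  qed
  then show ?thesis
    unfolding DERIV_def by (rule LIM_zero_cancel)
qed

lemma continuous_on_trunc_laplace: "continuous_on S (trunc_laplace b)"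
  by (rule DERIV_continuous_on[OF has_field_derivative_at_within[OF DERIV_trunc_laplace]])

lemma trunc_laplace_mono: "b \<le> c \<Longrightarrow> trunc_laplace b t \<le> trunc_laplace c t"
  unfolding trunc_laplace_def
  by (intro integral_mono integrable_trunc) (auto simp: indicator_def)

lemma trunc_laplace_le: "ennreal (trunc_laplace b t) \<le> \<psi> t"
proof -
  have "ennreal (trunc_laplace b t) = (\<integral>\<^sup>+ \<omega>. ennreal (indicator {-b..b} (T \<omega>) * exp (- t * T \<omega>)) \<partial>N)"
    unfolding trunc_laplace_def by (intro nn_integral_eq_integral[symmetric] integrable_trunc) auto
  also have "\<dots> \<le> \<psi> t"
    unfolding laplace_def by (intro nn_integral_mono) (auto simp: indicator_def)
  finally show ?thesis .
qed

text \<open>The offset c lets the cut-offs start above any prescribed threshold.\<close>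

lemma laplace_eq_SUP_trunc: "\<psi> t = (SUP n. ennreal (trunc_laplace (c + real n) t))"
proof -
  have "(SUP n. ennreal (trunc_laplace (c + real n) t))
      = (SUP n. \<integral>\<^sup>+ \<omega>. ennreal (indicator {-(c + real n)..c + real n} (T \<omega>) * exp (- t * T \<omega>)) \<partial>N)"
    unfolding trunc_laplace_def
    by (intro SUP_cong nn_integral_eq_integral[symmetric] integrable_trunc) auto
  also have "\<dots> = (\<integral>\<^sup>+ \<omega>. (SUP n. ennreal (indicator {-(c + real n)..c + real n} (T \<omega>) * exp (- t * T \<omega>))) \<partial>N)"
    by (rule nn_integral_monotone_convergence_SUP[symmetric])
       (auto simp: incseq_def le_fun_def indicator_def)
  also have "\<dots> = \<psi> t"
    unfolding laplace_def
  proof (rule nn_integral_cong)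
    fix \<omega>
    obtain n :: nat where n: "\<bar>T \<omega>\<bar> - c \<le> real n" using real_arch_simple by blast
    show "(SUP n. ennreal (indicator {-(c + real n)..c + real n} (T \<omega>) * exp (- t * T \<omega>))) = ennreal (exp (- t * T \<omega>))"
    proof (rule antisym)
      show "(SUP n. ennreal (indicator {-(c + real n)..c + real n} (T \<omega>) * exp (- t * T \<omega>))) \<le> ennreal (exp (- t * T \<omega>))"
        by (intro SUP_least) (auto simp: indicator_def)
      have "T \<omega> \<in> {-(c + real n)..c + real n}" using n by auto
      then show "ennreal (exp (- t * T \<omega>)) \<le> (SUP n. ennreal (indicator {-(c + real n)..c + real n} (T \<omega>) * exp (- t * T \<omega>)))"
        by (intro SUP_upper2[of n]) auto
    qed
  qed
  finally show ?thesis by simp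
qed

text \<open>Some part of {T < 0} on which T is bounded and bounded away from 0 has positive
  probability. Every large truncation retains it, and on it exp (-t T) grows at least linearly in t.
  The point is that K is uniform in b, so that minimisers for different cut-offs stay in one compact
  interval.\<close>

lemma trunc_laplace_coercive:
  assumes "prob {\<omega> \<in> space N. T \<omega> < 0} > 0"
  shows "\<exists>b0. \<forall>c. \<exists>K\<ge>0. \<forall>t\<ge>K. \<forall>b\<ge>b0. trunc_laplace b t > c"
proof -
  \<comment> \<open>These sets exhaust {T < 0}: n controls both the distance from 0 and the size of
    T.\<close>
  define S where "S n = {\<omega> \<in> space N. T \<omega> \<le> - 1 / real (Suc n) \<and> - real n \<le> T \<omega>}" for n
  have [measurable]: "S n \<in> sets N" for n unfolding S_def by measurable
  have "\<exists>n. prob (S n) > 0"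
  proof (rule ccontr)
    assume "\<not> ?thesis"
    then have "prob (S n) = 0" for n
      using measure_nonneg[of N "S n"] by (auto simp: not_less intro: antisym)
    then have "AE \<omega> in N. \<omega> \<notin> S n" for n
      by (intro AE_not_in) (simp add: null_sets_def emeasure_eq_measure)
    then have "AE \<omega> in N. \<forall>n. \<omega> \<notin> S n"
      by (subst AE_all_countable) auto
    then have "AE \<omega> in N. \<not> T \<omega> < 0"
      using AE_space
    proof eventually_elim
      case (elim \<omega>)
      show ?case
      proof
        assume "T \<omega> < 0"
        then obtain m where m: "inverse (real (Suc m)) < - T \<omega>" using reals_Archimedean[of "- T \<omega>"] by auto
        obtain k :: nat where k: "- T \<omega> \<le> real k" using real_arch_simple by blast
        have "1 / real (Suc (max m k)) \<le> 1 / real (Suc m)" by (intro divide_left_mono) auto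
        then have "T \<omega> \<le> - 1 / real (Suc (max m k))" "- real (max m k) \<le> T \<omega>"
          using m k by (simp_all add: inverse_eq_divide del: of_nat_Suc)
        then have "\<omega> \<in> S (max m k)"
          using m k elim unfolding S_def by (auto simp add: inverse_eq_divide simp del: of_nat_Suc)
        then show False using elim by blast
      qed
    qed
    then have "prob {\<omega> \<in> space N. T \<omega> < 0} = 0" by (subst prob_eq_0) auto
    then show False using assms by simp
  qed
  then obtain n where n: "prob (S n) > 0" by blast
  define e where "e = 1 / real (Suc n)"
  have e: "e > 0" by (simp add: e_def)
  have low: "trunc_laplace b t \<ge> prob (S n) * (t * e)" if "b \<ge> real n" "t \<ge> 0" for b t
  proof -
    have "prob (S n) * (t * e) = (\<integral>\<omega>. indicator (S n) \<omega> * (t * e) \<partial>N)"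
      by simp
    also have "\<dots> \<le> trunc_laplace b t"
      unfolding trunc_laplace_def
    proof (rule integral_mono)
      show "indicator (S n) \<omega> * (t * e) \<le> indicator {-b..b} (T \<omega>) * exp (- t * T \<omega>)" if "\<omega> \<in> space N" for \<omega>
      proof (cases "\<omega> \<in> S n")
        case True
        have "t * e \<le> t * (- T \<omega>)"
          using True \<open>t \<ge> 0\<close> by (intro mult_left_mono) (auto simp: S_def e_def)
        also have "\<dots> \<le> exp (- t * T \<omega>)"
          using exp_ge_add_one_self[of "- t * T \<omega>"] by simp
        finally have "t * e \<le> exp (- t * T \<omega>)" .
        moreover have "T \<omega> \<in> {-b..b}"
        proof -
          have "- 1 / real (Suc n) \<le> 0" by simp
          then have "T \<omega> \<le> 0" using True unfolding S_def by (auto intro: order_trans)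
          then show ?thesis using True \<open>b \<ge> real n\<close> unfolding S_def by auto
        qed
        ultimately show ?thesis using True by simp
      qed auto
      show "integrable N (\<lambda>\<omega>. indicator (S n) \<omega> * (t * e))"
        by (intro integrable_mult_left integrable_real_indicator) (auto simp: emeasure_eq_measure)
    qed (rule integrable_trunc)
    finally show ?thesis .
  qed
  show ?thesis
  proof (rule exI[of _ "real n"], rule allI)
    fix c :: real
    define K where "K = (\<bar>c\<bar> + 1) / (prob (S n) * e)"
    have "K \<ge> 0" using n e by (simp add: K_def)
    moreover have "trunc_laplace b t > c" if "t \<ge> K" "b \<ge> real n" for b t
    proof -
      have "c < \<bar>c\<bar> + 1" by simp
      also have "\<dots> = prob (S n) * (K * e)" using n e by (simp add: K_def)
      also have "\<dots> \<le> prob (S n) * (t * e)"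
        using that e by (intro mult_left_mono mult_right_mono) auto
      also have "\<dots> \<le> trunc_laplace b t" using that \<open>K \<ge> 0\<close> by (intro low) auto
      finally show ?thesis .
    qed
    ultimately show "\<exists>K\<ge>0. \<forall>t\<ge>K. \<forall>b\<ge>real n. trunc_laplace b t > c" by blast
  qed
qed

lemma trunc_laplace_attains_min:
  assumes "prob {\<omega> \<in> space N. T \<omega> < 0} > 0"
  shows "\<exists>b0. \<forall>b\<ge>b0. \<exists>g\<ge>0. \<forall>t\<ge>0. trunc_laplace b g \<le> trunc_laplace b t"
proof -
  from trunc_laplace_coercive[OF assms]
  obtain b0 where b0: "\<forall>c. \<exists>K\<ge>0. \<forall>t\<ge>K. \<forall>b\<ge>b0. trunc_laplace b t > c" ..
  have "\<exists>g\<ge>0. \<forall>t\<ge>0. trunc_laplace b g \<le> trunc_laplace b t" if "b \<ge> b0" for b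
  proof -
    from b0[THEN spec, of "trunc_laplace b 0"]
    obtain K where "K \<ge> 0" and K': "\<forall>t\<ge>K. \<forall>b'\<ge>b0. trunc_laplace b' t > trunc_laplace b 0"
      by (elim exE conjE)
    have K: "trunc_laplace b t > trunc_laplace b 0" if "t \<ge> K" for t
      using K' that \<open>b \<ge> b0\<close> by simp
    have "{0..K} \<noteq> {}" using \<open>K \<ge> 0\<close> by simp
    from continuous_attains_inf[OF compact_Icc this continuous_on_trunc_laplace[where b = b]]
    obtain g where "g \<in> {0..K}" and g: "\<forall>t\<in>{0..K}. trunc_laplace b g \<le> trunc_laplace b t"
      by (elim bexE)
    have "trunc_laplace b g \<le> trunc_laplace b t" if "t \<ge> 0" for t
    proof (cases "t \<le> K")
      case True
      then show ?thesis using g that by simp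
    next
      case False
      then have "trunc_laplace b 0 < trunc_laplace b t" by (intro K) simp
      moreover have "trunc_laplace b g \<le> trunc_laplace b 0" using g \<open>K \<ge> 0\<close> by simp
      ultimately show ?thesis by simp
    qed
    then show ?thesis using \<open>g \<in> {0..K}\<close> by (intro exI[of _ g]) simp
  qed
  then show ?thesis by (intro exI[of _ b0]) simp
qed

text \<open>This exchanges the infimum over t with the supremum over b. The sublevel sets of the
  truncated transforms are compact and nonempty, lie in one interval by coercivity, and shrink as b
  grows. A common point satisfies the bound for all cut-offs, hence for \<psi> by monotone
  convergence.\<close>

lemma laplace_le_if_trunc_le:
  assumes neg: "prob {\<omega> \<in> space N. T \<omega> < 0} > 0"
    and ex: "\<And>b. b \<ge> b1 \<Longrightarrow> \<exists>t\<ge>0. trunc_laplace b t \<le> c"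
  shows "\<exists>t\<ge>0. \<psi> t \<le> ennreal c"
proof -
  from trunc_laplace_coercive[OF neg]
  obtain b0 where b0: "\<forall>c. \<exists>K\<ge>0. \<forall>t\<ge>K. \<forall>b\<ge>b0. trunc_laplace b t > c" ..
  from b0[THEN spec, of c]
  obtain K where "\<forall>t\<ge>K. \<forall>b\<ge>b0. trunc_laplace b t > c"
    by (elim exE conjE)
  then have K: "trunc_laplace b t > c" if "t \<ge> K" "b \<ge> b0" for t b
    using that by simp
  define b where "b n = max b0 b1 + real n" for n
  define S where "S n = {t \<in> {0..K}. trunc_laplace (b n) t \<le> c}" for n
  have "(\<Inter>n. S n) \<noteq> {}"
  proof (rule compact_nest)
    fix n
    have "S n = {0..K} \<inter> trunc_laplace (b n) -` {..c}" unfolding S_def by auto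
    then have "closedin (top_of_set {0..K}) (S n)"
      using continuous_closedin_preimage[OF continuous_on_trunc_laplace closed_atMost, of "{0..K}" "b n" c]
      by simp
    then show "compact (S n)" by (rule closedin_compact[OF compact_Icc])
    have bn: "b n \<ge> b0" "b n \<ge> b1" by (simp_all add: b_def)
    from ex[OF bn(2)] obtain t where t: "t \<ge> 0" "trunc_laplace (b n) t \<le> c" by (elim exE conjE)
    have "\<not> t \<ge> K" using K[of t "b n"] t bn by linarith
    with t have "t \<in> S n" by (simp add: S_def)
    then show "S n \<noteq> {}" by (rule ex_in_conv[THEN iffD1, OF exI])
  next
    fix m n :: nat assume "m \<le> n"
    then have "trunc_laplace (b m) t \<le> trunc_laplace (b n) t" for t
      by (intro trunc_laplace_mono) (simp add: b_def)
    then show "S n \<subseteq> S m"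
      unfolding S_def by (safe intro!: CollectI) (meson order_trans)+
  qed
  then obtain t where "t \<in> (\<Inter>n. S n)" by (meson ex_in_conv)
  then have t: "t \<in> S n" for n by simp
  have "\<psi> t \<le> ennreal c"
    unfolding laplace_eq_SUP_trunc[of t "max b0 b1"]
    using t by (intro SUP_least ennreal_leI) (auto simp: S_def b_def)
  then show ?thesis using t[of 0] by (auto simp: S_def)
qed

section \<open>The infimum of the transform and where it is attained\<close>

lemma laplace_0: "\<psi> 0 = 1"
  by (simp add: laplace_def emeasure_space_1)

lemma laplace_inf_le: "t \<ge> 0 \<Longrightarrow> laplace_inf N T \<le> \<psi> t"
  unfolding laplace_inf_def by (intro INF_lower) auto

lemma laplace_inf_le_1: "laplace_inf N T \<le> 1"
  using laplace_inf_le[of 0] by (simp add: laplace_0)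

lemma less_decay_rate_iff: "ereal a < decay_rate N T \<longleftrightarrow> laplace_inf N T < ennreal (exp (- a))"
  and decay_rate_less_iff: "decay_rate N T < ereal a \<longleftrightarrow> ennreal (exp (- a)) < laplace_inf N T"
  and eq_decay_rate_iff: "ereal a = decay_rate N T \<longleftrightarrow> laplace_inf N T = ennreal (exp (- a))"
proof -
  consider "laplace_inf N T = 0" | i where "laplace_inf N T = ennreal i" "i > 0"
    using laplace_inf_le_1 by (cases "laplace_inf N T") (auto simp: le_less top_unique)
  then have "(ereal a < decay_rate N T \<longleftrightarrow> laplace_inf N T < ennreal (exp (- a))) \<and>
    (decay_rate N T < ereal a \<longleftrightarrow> ennreal (exp (- a)) < laplace_inf N T) \<and>
    (ereal a = decay_rate N T \<longleftrightarrow> laplace_inf N T = ennreal (exp (- a)))"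
  proof cases
    case 1
    then show ?thesis by (simp add: decay_rate_def ennreal_eq_0_iff)
  next
    case 2
    then have R: "decay_rate N T = ereal (- ln i)" by (simp add: decay_rate_def ennreal_eq_0_iff)
    have "a < - ln i \<longleftrightarrow> i < exp (- a)" "- ln i < a \<longleftrightarrow> exp (- a) < i" "a = - ln i \<longleftrightarrow> i = exp (- a)"
      using exp_less_cancel_iff[of "ln i" "- a"] exp_less_cancel_iff[of "- a" "ln i"] 2
      by (auto simp: exp_ln)
    then show ?thesis using 2 unfolding R 2(1) by (simp add: ennreal_less_iff)
  qed
  then show "ereal a < decay_rate N T \<longleftrightarrow> laplace_inf N T < ennreal (exp (- a))"
    "decay_rate N T < ereal a \<longleftrightarrow> ennreal (exp (- a)) < laplace_inf N T"
    "ereal a = decay_rate N T \<longleftrightarrow> laplace_inf N T = ennreal (exp (- a))" by blast+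
qed

text \<open>Every truncated minimum lies below inf \<psi>, because truncation only decreases the
  transform. The compactness lemma with c = inf \<psi> then produces a point where \<psi> itself is
  that small.\<close>

lemma laplace_inf_attained:
  assumes neg: "prob {\<omega> \<in> space N. T \<omega> < 0} > 0"
  shows "\<exists>t\<ge>0. \<psi> t = laplace_inf N T"
proof -
  from trunc_laplace_attains_min[OF neg]
  obtain b0 where b0: "\<forall>b\<ge>b0. \<exists>g\<ge>0. \<forall>t\<ge>0. trunc_laplace b g \<le> trunc_laplace b t" ..
  have fin: "laplace_inf N T = ennreal (enn2real (laplace_inf N T))"
    using laplace_inf_le_1 by (cases "laplace_inf N T") (auto simp: top_unique)
  have "\<exists>t\<ge>0. trunc_laplace b t \<le> enn2real (laplace_inf N T)" if "b \<ge> b0" for b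
  proof -
    from b0 that have "\<exists>g\<ge>0. \<forall>t\<ge>0. trunc_laplace b g \<le> trunc_laplace b t" by simp
    then obtain g where g: "g \<ge> 0" "\<forall>t\<ge>0. trunc_laplace b g \<le> trunc_laplace b t" by (elim exE conjE)
    have "ennreal (trunc_laplace b g) \<le> laplace_inf N T"
      unfolding laplace_inf_def
    proof (rule INF_greatest)
      fix t :: real assume "t \<in> {0..}"
      then have "ennreal (trunc_laplace b g) \<le> ennreal (trunc_laplace b t)"
        using g by (intro ennreal_leI) simp
      also have "\<dots> \<le> \<psi> t" by (rule trunc_laplace_le)
      finally show "ennreal (trunc_laplace b g) \<le> \<psi> t" .
    qed
    then have "trunc_laplace b g \<le> enn2real (laplace_inf N T)"
      by (subst (asm) fin) (simp add: ennreal_le_iff)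
    with g(1) show ?thesis by (intro exI[of _ g] conjI)
  qed
  then have "\<exists>t\<ge>0. \<psi> t \<le> ennreal (enn2real (laplace_inf N T))"
    by (rule laplace_le_if_trunc_le[OF neg])
  then obtain t where "t \<ge> 0" "\<psi> t \<le> laplace_inf N T" unfolding fin[symmetric] by (elim exE conjE)
  then show ?thesis using laplace_inf_le[of t] by (intro exI[of _ t]) simp
qed

text \<open>For nonnegative T the infimum is approached as t tends to infinity, where exp (-t T)
  converges boundedly to the indicator of {T = 0}. An atom of mass 0 is included; then R is
  infinite.\<close>

lemma laplace_inf_nonneg:
  assumes nonneg: "AE \<omega> in N. T \<omega> \<ge> 0"
  shows "laplace_inf N T = ennreal (prob {\<omega> \<in> space N. T \<omega> = 0})"
proof (rule antisym)
  let ?S = "{\<omega> \<in> space N. T \<omega> = 0}"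
  have "(\<lambda>n. \<integral>\<^sup>+ \<omega>. ennreal (exp (- real n * T \<omega>)) \<partial>N) \<longlonglongrightarrow> (\<integral>\<^sup>+ \<omega>. indicator ?S \<omega> \<partial>N)"
  proof (rule nn_integral_dominated_convergence[where w = "\<lambda>_. 1"])
    show "AE \<omega> in N. (\<lambda>n. ennreal (exp (- real n * T \<omega>))) \<longlonglongrightarrow> indicator ?S \<omega>"
      using nonneg AE_space
    proof eventually_elim
      case (elim \<omega>)
      show ?case
      proof (cases "T \<omega> = 0")
        case True
        then show ?thesis using elim by simp
      next
        case False
        then have "exp (- T \<omega>) < 1" using elim by simp
        then have "(\<lambda>n. exp (- T \<omega>) ^ n) \<longlonglongrightarrow> 0" by (intro LIMSEQ_power_zero) simp
        then have "(\<lambda>n. exp (- real n * T \<omega>)) \<longlonglongrightarrow> 0" by (simp flip: exp_of_nat_mult)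
        from tendsto_ennrealI[OF this] show ?thesis using False by simp
      qed
    qed
    show "AE \<omega> in N. ennreal (exp (- real n * T \<omega>)) \<le> 1" for n
      using nonneg by eventually_elim (simp flip: ennreal_1)
  qed (auto simp: emeasure_space_1)
  then have "(\<lambda>n. \<psi> (real n)) \<longlonglongrightarrow> ennreal (prob ?S)"
    by (simp add: laplace_def emeasure_eq_measure)
  then show "laplace_inf N T \<le> ennreal (prob ?S)"
    by (rule tendsto_lowerbound) (auto intro!: always_eventually laplace_inf_le)
  have "ennreal (prob ?S) \<le> \<psi> t" for t
  proof -
    have "ennreal (prob ?S) = (\<integral>\<^sup>+ \<omega>. indicator ?S \<omega> \<partial>N)" by (simp add: emeasure_eq_measure)
    also have "\<dots> \<le> \<psi> t" unfolding laplace_def by (intro nn_integral_mono) (auto simp: indicator_def)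
    finally show ?thesis .
  qed
  then show "ennreal (prob ?S) \<le> laplace_inf N T"
    unfolding laplace_inf_def by (intro INF_greatest)
qed

lemma integrable_exp_if_laplace_finite:
  assumes "\<psi> t < \<infinity>"
  shows "integrable N (\<lambda>\<omega>. exp (- t * T \<omega>))" "\<psi> t = ennreal (\<integral>\<omega>. exp (- t * T \<omega>) \<partial>N)"
proof -
  show i: "integrable N (\<lambda>\<omega>. exp (- t * T \<omega>))"
    using assms by (intro integrableI_nonneg) (auto simp: laplace_def)
  show "\<psi> t = ennreal (\<integral>\<omega>. exp (- t * T \<omega>) \<partial>N)"
    unfolding laplace_def by (rule nn_integral_eq_integral[OF i]) simp
qed

text \<open>Strict convexity in explicit form: the square of exp (-s T / 2) - exp (-t T / 2) has
  mean \<psi>(s) + \<psi>(t) - 2 \<psi>((s + t) / 2), which is at most 0 for two minimisers. So the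
  two exponentials agree almost surely, and for distinct s and t this means T = 0 almost
  surely.\<close>

lemma laplace_argmin_unique:
  assumes T0: "prob {\<omega> \<in> space N. T \<omega> = 0} \<noteq> 1"
    and s: "s \<ge> 0" "\<psi> s = laplace_inf N T" and t: "t \<ge> 0" "\<psi> t = laplace_inf N T"
  shows "s = t"
proof (rule ccontr)
  assume "s \<noteq> t"
  have fin: "\<psi> s < \<infinity>" "\<psi> t < \<infinity>"
    using s t laplace_inf_le_1 by (auto intro: le_less_trans)
  note int_s = integrable_exp_if_laplace_finite[OF fin(1)] and int_t = integrable_exp_if_laplace_finite[OF fin(2)]
  let ?u = "(s + t) / 2"
  let ?d = "\<lambda>\<omega>. (exp (- (s / 2) * T \<omega>) - exp (- (t / 2) * T \<omega>))\<^sup>2"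
  have d_eq: "?d \<omega> = exp (- s * T \<omega>) + exp (- t * T \<omega>) - 2 * exp (- ?u * T \<omega>)" for \<omega>
    by (simp add: power2_eq_square algebra_simps flip: exp_add)
  have "exp (- ?u * T \<omega>) \<le> exp (- s * T \<omega>) + exp (- t * T \<omega>)" for \<omega>
    using d_eq[of \<omega>] zero_le_power2[of "exp (- (s / 2) * T \<omega>) - exp (- (t / 2) * T \<omega>)"]
      exp_ge_zero[of "- ?u * T \<omega>"] by linarith
  then have iu: "integrable N (\<lambda>\<omega>. exp (- ?u * T \<omega>))"
    by (intro Bochner_Integration.integrable_bound[OF Bochner_Integration.integrable_add[OF int_s(1) int_t(1)]]) auto
  have id: "integrable N ?d" unfolding d_eq using int_s(1) int_t(1) iu by simp
  have "\<psi> s \<le> \<psi> ?u" using s t laplace_inf_le[of ?u] by simp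
  moreover have "\<psi> ?u = ennreal (\<integral>\<omega>. exp (- ?u * T \<omega>) \<partial>N)"
    unfolding laplace_def by (rule nn_integral_eq_integral[OF iu]) simp
  ultimately have 1: "(\<integral>\<omega>. exp (- s * T \<omega>) \<partial>N) \<le> (\<integral>\<omega>. exp (- ?u * T \<omega>) \<partial>N)"
    using int_s(2) by (simp add: ennreal_le_iff)
  have "ennreal (\<integral>\<omega>. exp (- s * T \<omega>) \<partial>N) = ennreal (\<integral>\<omega>. exp (- t * T \<omega>) \<partial>N)"
    using s t int_s(2) int_t(2) by simp
  then have 2: "(\<integral>\<omega>. exp (- s * T \<omega>) \<partial>N) = (\<integral>\<omega>. exp (- t * T \<omega>) \<partial>N)"
    by (subst (asm) ennreal_inj) auto
  have "(\<integral>\<omega>. ?d \<omega> \<partial>N) = (\<integral>\<omega>. exp (- s * T \<omega>) \<partial>N) + (\<integral>\<omega>. exp (- t * T \<omega>) \<partial>N)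
      - 2 * (\<integral>\<omega>. exp (- ?u * T \<omega>) \<partial>N)"
    unfolding d_eq using int_s(1) int_t(1) iu by simp
  then have "(\<integral>\<omega>. ?d \<omega> \<partial>N) = 0"
    using 1 2 Bochner_Integration.integral_nonneg[of N ?d] by simp
  then have "AE \<omega> in N. ?d \<omega> = 0"
    using integral_nonneg_eq_0_iff_AE[OF id] by simp
  then have "AE \<omega> in N. T \<omega> = 0"
    by eventually_elim (use \<open>s \<noteq> t\<close> in auto)
  then have "prob {\<omega> \<in> space N. T \<omega> = 0} = 1"
    by (subst prob_Collect_eq_1) auto
  with T0 show False by simp
qed

lemma laplace_argmin:
  assumes "prob {\<omega> \<in> space N. T \<omega> < 0} > 0" "prob {\<omega> \<in> space N. T \<omega> = 0} \<noteq> 1"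
  shows "laplace_argmin N T \<ge> 0" "\<psi> (laplace_argmin N T) = laplace_inf N T"
proof -
  have "\<exists>!t. 0 \<le> t \<and> \<psi> t = laplace_inf N T"
    using laplace_inf_attained[OF assms(1)] laplace_argmin_unique[OF assms(2)] by blast
  from theI'[OF this] show "laplace_argmin N T \<ge> 0" "\<psi> (laplace_argmin N T) = laplace_inf N T"
    unfolding laplace_argmin_def by auto
qed

text \<open>At a minimiser the difference quotients of \<open>\<psi>\<close> from the left have a sign, and they decrease
  to the derivative of the integrand pointwise; Fatou's lemma then gives integrability even if
  \<open>\<psi>\<close> is infinite to the right of \<open>g\<close>.\<close>

lemma left_derivative_at_minimiser:
  assumes g: "g > 0" and fin: "\<psi> g < \<infinity>" and min: "\<And>s. s \<ge> 0 \<Longrightarrow> \<psi> g \<le> \<psi> s"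
  shows "integrable N (\<lambda>\<omega>. exp (- g * T \<omega>) * T \<omega>)"
    and "((\<lambda>s. enn2real (\<psi> s)) has_real_derivative - (\<integral>\<omega>. exp (- g * T \<omega>) * T \<omega> \<partial>N)) (at_left g)"
    and "(\<integral>\<omega>. exp (- g * T \<omega>) * T \<omega> \<partial>N) \<ge> 0"
proof -
  define k where "k h y = (exp (h * y) - 1) / h" for h y :: real
  have k_meas [measurable]: "k h \<in> borel_measurable borel" for h
    unfolding k_def by measurable
  have fin_s: "\<psi> s < \<infinity>" if "0 \<le> s" "s \<le> g" for s
  proof -
    have "\<psi> s \<le> (\<integral>\<^sup>+ \<omega>. 1 + ennreal (exp (- g * T \<omega>)) \<partial>N)"
      unfolding laplace_def
    proof (rule nn_integral_mono)
      fix \<omega>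
      have "exp (- s * T \<omega>) \<le> 1 + exp (- g * T \<omega>)"
      proof (cases "T \<omega> \<ge> 0")
        case True
        then have "exp (- s * T \<omega>) \<le> 1" using that by simp
        then show ?thesis by (simp add: add_increasing2)
      next
        case False
        then have "exp (- s * T \<omega>) \<le> exp (- g * T \<omega>)" using that by (simp add: mult_right_mono_neg)
        then show ?thesis by (rule add_increasing[OF zero_le_one])
      qed
      then show "ennreal (exp (- s * T \<omega>)) \<le> 1 + ennreal (exp (- g * T \<omega>))"
        by (metis ennreal_1 ennreal_leI ennreal_plus exp_ge_zero zero_le_one)
    qed
    also have "\<dots> < \<infinity>"
      using fin unfolding laplace_def by (subst nn_integral_add) (auto simp: emeasure_space_1)
    finally show ?thesis .
  qed
  have int_s: "integrable N (\<lambda>\<omega>. exp (- s * T \<omega>))" if "0 \<le> s" "s \<le> g" for s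
    using integrable_exp_if_laplace_finite(1)[OF fin_s[OF that]] .
  have psi_s: "enn2real (\<psi> s) = (\<integral>\<omega>. exp (- s * T \<omega>) \<partial>N)" if "0 \<le> s" "s \<le> g" for s
    using integrable_exp_if_laplace_finite(2)[OF fin_s[OF that]] by simp
  have k_eq: "exp (- g * T \<omega>) * k h (T \<omega>) = (exp (- (g - h) * T \<omega>) - exp (- g * T \<omega>)) / h" for h \<omega>
    unfolding k_def by (simp add: algebra_simps flip: exp_add)
  have int_k: "integrable N (\<lambda>\<omega>. exp (- g * T \<omega>) * k h (T \<omega>))"
    and quot: "(\<integral>\<omega>. exp (- g * T \<omega>) * k h (T \<omega>) \<partial>N) = (enn2real (\<psi> (g - h)) - enn2real (\<psi> g)) / h"
    if "0 < h" "h \<le> g" for h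
    unfolding k_eq using int_s[of "g - h"] int_s[of g] psi_s[of "g - h"] psi_s[of g] that g by simp_all
  have quot_nonneg: "(\<integral>\<omega>. exp (- g * T \<omega>) * k h (T \<omega>) \<partial>N) \<ge> 0" if "0 < h" "h \<le> g" for h
  proof -
    have "enn2real (\<psi> g) \<le> enn2real (\<psi> (g - h))"
      using min[of "g - h"] fin_s[of "g - h"] that by (intro enn2real_mono) auto
    then show ?thesis using quot[OF that] that by simp
  qed
  \<comment> \<open>Measured from the quotient with the largest admissible step h = g, the
    integrands become nonnegative by convexity. Their means are at most \<open>c\<close>, because at
    a minimiser the quotient with step h has nonnegative mean. This is the uniform bound that
    Fatou's lemma needs.\<close>
  define F where "F h \<omega> = exp (- g * T \<omega>) * k g (T \<omega>) - exp (- g * T \<omega>) * k h (T \<omega>)" for h \<omega>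
  have F_nonneg: "F h \<omega> \<ge> 0" if "0 < h" "h \<le> g" for h \<omega>
    using mult_left_mono[OF exp_quotient_bounds(2)[OF that, of "T \<omega>"], of "exp (- g * T \<omega>)"]
    unfolding F_def k_def by simp
  define c where "c = (\<integral>\<omega>. exp (- g * T \<omega>) * k g (T \<omega>) \<partial>N)"
  have F_le: "(\<integral>\<^sup>+ \<omega>. ennreal (F h \<omega>) \<partial>N) \<le> ennreal c" if "0 < h" "h \<le> g" for h
  proof -
    have "integrable N (F h)" unfolding F_def using int_k[OF that] int_k[of g] g by simp
    then have "(\<integral>\<^sup>+ \<omega>. ennreal (F h \<omega>) \<partial>N) = ennreal (\<integral>\<omega>. F h \<omega> \<partial>N)"
      using F_nonneg[OF that] by (intro nn_integral_eq_integral) auto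
    also have "(\<integral>\<omega>. F h \<omega> \<partial>N) = c - (\<integral>\<omega>. exp (- g * T \<omega>) * k h (T \<omega>) \<partial>N)"
      unfolding F_def c_def using int_k[OF that] int_k[of g] g by simp
    also have "\<dots> \<le> c" using quot_nonneg[OF that] by simp
    finally show ?thesis by (simp add: ennreal_leI)
  qed
  have k_lim: "(\<lambda>n. k (S n) y) \<longlonglongrightarrow> y" if "\<And>n. S n > 0" "S \<longlonglongrightarrow> 0" for S y
    unfolding k_def
    by (rule filterlim_compose[OF exp_quotient_tendsto filterlim_atI])
       (use that in \<open>auto simp: less_imp_neq[symmetric]\<close>)
  define h where "h n = g / real (Suc n)" for n
  have h: "0 < h n" "h n \<le> g" for n
    using g by (auto simp: h_def field_simps)
  have h_lim: "h \<longlonglongrightarrow> 0"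
    unfolding h_def using LIMSEQ_Suc[OF lim_const_over_n[of g]] by simp
  define F0 where "F0 \<omega> = exp (- g * T \<omega>) * k g (T \<omega>) - exp (- g * T \<omega>) * T \<omega>" for \<omega>
  have [measurable]: "F0 \<in> borel_measurable N" "F (h n) \<in> borel_measurable N" for n
    unfolding F0_def F_def by measurable
  have F0_nonneg: "F0 \<omega> \<ge> 0" for \<omega>
    using mult_left_mono[OF exp_quotient_bounds(1)[of g g "T \<omega>"], of "exp (- g * T \<omega>)"] g
    unfolding F0_def k_def by simp
  have "(\<lambda>n. F (h n) \<omega>) \<longlonglongrightarrow> F0 \<omega>" for \<omega>
    unfolding F_def F0_def by (intro tendsto_diff tendsto_mult tendsto_const k_lim h h_lim)
  then have "(\<lambda>n. ennreal (F (h n) \<omega>)) \<longlonglongrightarrow> ennreal (F0 \<omega>)" for \<omega>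
    by (rule tendsto_ennrealI)
  then have liminf: "liminf (\<lambda>n. ennreal (F (h n) \<omega>)) = ennreal (F0 \<omega>)" for \<omega>
    by (intro lim_imp_Liminf) auto
  have "(\<integral>\<^sup>+ \<omega>. ennreal (F0 \<omega>) \<partial>N) \<le> liminf (\<lambda>n. \<integral>\<^sup>+ \<omega>. ennreal (F (h n) \<omega>) \<partial>N)"
    unfolding liminf[symmetric] by (intro nn_integral_liminf) measurable
  also have "\<dots> \<le> limsup (\<lambda>n. \<integral>\<^sup>+ \<omega>. ennreal (F (h n) \<omega>) \<partial>N)"
    by (intro Liminf_le_Limsup) auto
  also have "\<dots> \<le> ennreal c"
    by (intro Limsup_bounded always_eventually allI F_le h)
  finally have "integrable N F0"
    using F0_nonneg by (intro integrableI_nonneg) (auto simp: le_less_trans[OF _ ennreal_less_top])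
  then have "integrable N (\<lambda>\<omega>. exp (- g * T \<omega>) * k g (T \<omega>) - F0 \<omega>)"
    using int_k[of g] g by simp
  then show int: "integrable N (\<lambda>\<omega>. exp (- g * T \<omega>) * T \<omega>)"
    unfolding F0_def by simp

  \<comment> \<open>With T exp (-g T) now integrable, the two-sided bound T \<le> \<open>k h\<close>
    T \<le> \<open>k g\<close> T supplies a dominating function. Arbitrary step sequences are
    covered so that a genuine left limit results.\<close>
  have lim: "(\<lambda>n. \<integral>\<omega>. exp (- g * T \<omega>) * k (S n) (T \<omega>) \<partial>N) \<longlonglongrightarrow> (\<integral>\<omega>. exp (- g * T \<omega>) * T \<omega> \<partial>N)"
    if S: "\<And>n. 0 < S n" "\<And>n. S n \<le> g" "S \<longlonglongrightarrow> 0" for S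
  proof (rule integral_dominated_convergence
      [where w = "\<lambda>\<omega>. \<bar>exp (- g * T \<omega>) * k g (T \<omega>)\<bar> + \<bar>exp (- g * T \<omega>) * T \<omega>\<bar>"])
    show "integrable N (\<lambda>\<omega>. \<bar>exp (- g * T \<omega>) * k g (T \<omega>)\<bar> + \<bar>exp (- g * T \<omega>) * T \<omega>\<bar>)"
      using int int_k[of g] g by simp
    show "AE \<omega> in N. (\<lambda>n. exp (- g * T \<omega>) * k (S n) (T \<omega>)) \<longlonglongrightarrow> exp (- g * T \<omega>) * T \<omega>"
      by (intro AE_I2 tendsto_mult tendsto_const k_lim S)
    show "AE \<omega> in N. norm (exp (- g * T \<omega>) * k (S n) (T \<omega>))
        \<le> \<bar>exp (- g * T \<omega>) * k g (T \<omega>)\<bar> + \<bar>exp (- g * T \<omega>) * T \<omega>\<bar>" for n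
    proof (rule AE_I2)
      fix \<omega>
      have "\<bar>k (S n) (T \<omega>)\<bar> \<le> \<bar>k g (T \<omega>)\<bar> + \<bar>T \<omega>\<bar>"
        using exp_quotient_bounds[OF S(1)[of n] S(2)[of n], of "T \<omega>"] unfolding k_def by linarith
      then have "exp (- g * T \<omega>) * \<bar>k (S n) (T \<omega>)\<bar> \<le> exp (- g * T \<omega>) * (\<bar>k g (T \<omega>)\<bar> + \<bar>T \<omega>\<bar>)"
        by (intro mult_left_mono) auto
      then show "norm (exp (- g * T \<omega>) * k (S n) (T \<omega>))
        \<le> \<bar>exp (- g * T \<omega>) * k g (T \<omega>)\<bar> + \<bar>exp (- g * T \<omega>) * T \<omega>\<bar>"
        by (simp add: abs_mult distrib_left)
    qed
  qed auto
  show "(\<integral>\<omega>. exp (- g * T \<omega>) * T \<omega> \<partial>N) \<ge> 0"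
    by (rule tendsto_lowerbound[OF lim[of h]]) (use h h_lim quot_nonneg in auto)
  show "((\<lambda>s. enn2real (\<psi> s)) has_real_derivative - (\<integral>\<omega>. exp (- g * T \<omega>) * T \<omega> \<partial>N)) (at_left g)"
    unfolding has_field_derivative_iff
  proof (rule tendsto_at_left_sequentially[of 0])
    fix S :: "nat \<Rightarrow> real"
    assume S: "\<And>n. S n < g" "\<And>n. 0 < S n" "S \<longlonglongrightarrow> g"
    have "(\<lambda>n. - (\<integral>\<omega>. exp (- g * T \<omega>) * k (g - S n) (T \<omega>) \<partial>N))
        \<longlonglongrightarrow> - (\<integral>\<omega>. exp (- g * T \<omega>) * T \<omega> \<partial>N)"
      using S by (intro tendsto_minus lim) (auto intro!: tendsto_eq_intros less_imp_le)
    moreover have "- (\<integral>\<omega>. exp (- g * T \<omega>) * k (g - S n) (T \<omega>) \<partial>N)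
        = (enn2real (\<psi> (S n)) - enn2real (\<psi> g)) / (S n - g)" for n
      using S(1,2)[of n] by (subst quot) (auto simp: field_simps)
    ultimately show "(\<lambda>n. (enn2real (\<psi> (S n)) - enn2real (\<psi> g)) / (S n - g))
        \<longlonglongrightarrow> - (\<integral>\<omega>. exp (- g * T \<omega>) * T \<omega> \<partial>N)" by simp
  qed (use g in auto)
qed

end

subsection \<open>The renewal equation\<close>

text \<open>The last step is split off, not the first, so that the remaining sum is literally
  \<open>walk X n\<close>. Equality of laws then replaces that step by T, and the integral is taken
  over N.\<close>

lemma emeasure_walk_Suc:
  fixes T :: "'a \<Rightarrow> real"
  assumes "prob_space M" "prob_space.indep_vars M (\<lambda>_. borel) X UNIV"
    and T: "T \<in> borel_measurable N" and distr: "\<And>n. distr M borel (X n) = distr N borel T"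
    and "prob_space N"
  shows "emeasure M {\<omega> \<in> space M. walk X (Suc n) \<omega> \<le> x} =
    (\<integral>\<^sup>+ \<omega>. emeasure M {\<omega>' \<in> space M. walk X n \<omega>' \<le> x - T \<omega>} \<partial>N)"
proof -
  interpret M: prob_space M by fact
  interpret N: prob_space N by fact
  have rv [measurable]: "X i \<in> borel_measurable M" for i
    using assms(2) by (simp add: M.indep_vars_def)
  have [measurable]: "walk X k \<in> borel_measurable M" for k
    unfolding walk_def by measurable
  have "M.indep_vars (\<lambda>_. borel) X (insert n {..<n})"
    using assms(2) by (rule M.indep_vars_subset) simp
  then have indep: "M.indep_var borel (X n) borel (walk X n)"
    unfolding walk_def by (rule M.indep_vars_sum[rotated 2]) auto
  have fin: "finite_measure (distr M borel (walk X n))" "finite_measure (distr M borel (X n))"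
    by (auto intro!: prob_space.finite_measure M.prob_space_distr)
  have "emeasure M {\<omega> \<in> space M. walk X (Suc n) \<omega> \<le> x}
      = emeasure (distr M borel (\<lambda>\<omega>. X n \<omega> + walk X n \<omega>)) {..x}"
    by (subst emeasure_distr) (auto simp: walk_def add.commute intro!: arg_cong[of _ _ "emeasure M"])
  also have "\<dots> = emeasure (distr M borel (X n) \<star> distr M borel (walk X n)) {..x}"
    using M.sum_indep_random_variable[OF indep] by simp
  also have "\<dots> = (\<integral>\<^sup>+ t. emeasure (distr M borel (walk X n)) {s. s + t \<in> {..x}} \<partial>distr M borel (X n))"
    using fin by (intro convolution_emeasure) auto
  also have "\<dots> = (\<integral>\<^sup>+ t. emeasure (distr M borel (walk X n)) {..x - t} \<partial>distr N borel T)"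
    unfolding distr by (intro nn_integral_cong arg_cong2[of _ _ _ _ emeasure]) auto
  also have "\<dots> = (\<integral>\<^sup>+ t. emeasure M {\<omega>' \<in> space M. walk X n \<omega>' \<le> x - t} \<partial>distr N borel T)"
    by (intro nn_integral_cong, subst emeasure_distr)
       (auto intro!: arg_cong[of _ _ "emeasure M"])
  also have "\<dots> = (\<integral>\<^sup>+ \<omega>. emeasure M {\<omega>' \<in> space M. walk X n \<omega>' \<le> x - T \<omega>} \<partial>N)"
  proof -
    have "mono (\<lambda>t. measure M {\<omega>' \<in> space M. walk X n \<omega>' \<le> t})"
      by (intro monoI M.finite_measure_mono) auto
    then have "(\<lambda>t. measure M {\<omega>' \<in> space M. walk X n \<omega>' \<le> t}) \<in> borel_measurable borel"
      by (rule borel_measurable_mono)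
    then have "(\<lambda>t. emeasure M {\<omega>' \<in> space M. walk X n \<omega>' \<le> x - t}) \<in> borel_measurable borel"
      unfolding M.emeasure_eq_measure by measurable
    with T show ?thesis by (intro nn_integral_distr) auto
  qed
  finally show ?thesis .
qed

text \<open>This interface removes the walk and the space M from the argument. Finiteness is always
  derived from \<open>V_least\<close>, infiniteness from \<open>V_eq\<close> together with
  \<open>V_mono\<close>.\<close>

locale renewal_equation = real_random_variable N T
  for N :: "'a measure" and T :: "'a \<Rightarrow> real" +
  fixes a :: real and V :: "real \<Rightarrow> ennreal"
  assumes V_measurable [measurable]: "V \<in> borel_measurable borel"
    and V_mono: "mono V"
    and V_eq: "V x = indicator {0..} x + ennreal (exp a) * (\<integral>\<^sup>+ \<omega>. V (x - T \<omega>) \<partial>N)"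
    and V_least: "(\<And>x. indicator {0..} x + ennreal (exp a) * (\<integral>\<^sup>+ \<omega>. w (x - T \<omega>) \<partial>N) \<le> w x)
        \<Longrightarrow> V x \<le> w x"

lemma renewal_equation_exp_renewal:
  fixes T :: "'a \<Rightarrow> real"
  assumes "prob_space N" "prob_space M" "prob_space.indep_vars M (\<lambda>_. borel) X UNIV"
    and T [measurable]: "T \<in> borel_measurable N" and distr: "\<And>n. distr M borel (X n) = distr N borel T"
  shows "renewal_equation N T a (exp_renewal M X a)"
proof -
  interpret M: prob_space M by fact
  interpret N: prob_space N by fact
  have rv [measurable]: "X i \<in> borel_measurable M" for i
    using assms(3) by (simp add: M.indep_vars_def)
  have [measurable]: "walk X k \<in> borel_measurable M" for k
    unfolding walk_def by measurable
  define F where "F n x = ennreal (exp (a * real n) * measure M {\<omega> \<in> space M. walk X n \<omega> \<le> x})" for n x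
  have V: "exp_renewal M X a x = (\<Sum>n. F n x)" for x
    by (simp add: exp_renewal_def F_def)
  have mono_r: "mono (\<lambda>x. measure M {\<omega> \<in> space M. walk X n \<omega> \<le> x})" for n
    by (intro monoI M.finite_measure_mono) auto
  have F_mono: "F n x \<le> F n y" if "x \<le> y" for n x y
    unfolding F_def by (intro ennreal_leI mult_left_mono monoD[OF mono_r] that) auto
  have F_meas [measurable]: "F n \<in> borel_measurable borel" for n
    using borel_measurable_mono[OF mono_r[of n]] unfolding F_def by measurable
  have F_0: "F 0 x = indicator {0..} x" for x
    by (auto simp: F_def walk_def indicator_def M.prob_space)
  have F_eq: "F n x = ennreal (exp (a * real n)) * emeasure M {\<omega> \<in> space M. walk X n \<omega> \<le> x}" for n x
    by (simp add: F_def M.emeasure_eq_measure ennreal_mult)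
  have [measurable]: "(\<lambda>x. emeasure M {\<omega> \<in> space M. walk X n \<omega> \<le> x}) \<in> borel_measurable borel" for n
    using borel_measurable_mono[OF mono_r[of n]] unfolding M.emeasure_eq_measure by measurable
  have F_Suc: "F (Suc n) x = ennreal (exp a) * (\<integral>\<^sup>+ \<omega>. F n (x - T \<omega>) \<partial>N)" for n x
  proof -
    have "F (Suc n) x = ennreal (exp a) * (ennreal (exp (a * real n)) *
        (\<integral>\<^sup>+ \<omega>. emeasure M {\<omega>' \<in> space M. walk X n \<omega>' \<le> x - T \<omega>} \<partial>N))"
      using emeasure_walk_Suc[OF assms(2,3) T distr assms(1), of n x]
      by (simp add: F_eq algebra_simps exp_add ennreal_mult' flip: mult.assoc)
    then show ?thesis
      unfolding F_eq by (subst nn_integral_cmult) measurable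
  qed
  show ?thesis
  proof
    show "T \<in> borel_measurable N" by fact
    show "exp_renewal M X a \<in> borel_measurable borel"
      unfolding V[abs_def] by measurable
    show "mono (exp_renewal M X a)"
      unfolding V by (intro monoI suminf_le F_mono summableI)
    show "exp_renewal M X a x = indicator {0..} x
      + ennreal (exp a) * (\<integral>\<^sup>+ \<omega>. exp_renewal M X a (x - T \<omega>) \<partial>N)" for x
    proof -
      have "exp_renewal M X a x = F 0 x + (\<Sum>n. F (Suc n) x)"
        unfolding V using suminf_offset[of "\<lambda>n. F n x" 1] by (simp add: add.commute)
      also have "(\<Sum>n. F (Suc n) x) = ennreal (exp a) * (\<Sum>n. \<integral>\<^sup>+ \<omega>. F n (x - T \<omega>) \<partial>N)"
        unfolding F_Suc by simp
      also have "(\<Sum>n. \<integral>\<^sup>+ \<omega>. F n (x - T \<omega>) \<partial>N) = (\<integral>\<^sup>+ \<omega>. exp_renewal M X a (x - T \<omega>) \<partial>N)"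
        unfolding V by (rule nn_integral_suminf[symmetric]) measurable
      finally show ?thesis by (simp add: F_0)
    qed
    show "exp_renewal M X a x \<le> w x"
      if w: "\<And>x. indicator {0..} x + ennreal (exp a) * (\<integral>\<^sup>+ \<omega>. w (x - T \<omega>) \<partial>N) \<le> w x" for w x
    proof -
      \<comment> \<open>The partial sums are the iterates of the renewal equation started from 0, so
        by monotonicity they stay below every supersolution.\<close>
      have "(\<Sum>k<n. F k x) \<le> w x" for n
      proof (induction n arbitrary: x)
        case (Suc n)
        have "(\<Sum>k<Suc n. F k x) = F 0 x + (\<Sum>k<n. F (Suc k) x)"
          by (simp add: sum.lessThan_Suc_shift del: sum.lessThan_Suc)
        also have "(\<Sum>k<n. F (Suc k) x) = ennreal (exp a) * (\<integral>\<^sup>+ \<omega>. (\<Sum>k<n. F k (x - T \<omega>)) \<partial>N)"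
          unfolding F_Suc by (simp add: nn_integral_sum flip: sum_distrib_left)
        also have "\<dots> \<le> ennreal (exp a) * (\<integral>\<^sup>+ \<omega>. w (x - T \<omega>) \<partial>N)"
          by (intro mult_left_mono nn_integral_mono Suc.IH) auto
        finally show ?case
          using w[of x] by (auto simp: F_0 intro: order_trans add_left_mono)
      qed auto
      then show ?thesis
        unfolding V suminf_eq_SUP by (intro SUP_least)
    qed
  qed
qed

section \<open>Finiteness and infiniteness from the renewal equation\<close>

context renewal_equation
begin

lemma finite_if_laplace_less:
  assumes t: "t \<ge> 0" and less: "\<psi> t < ennreal (exp (- a))"
  shows "V x < \<infinity>"
proof -
  obtain p where p: "p \<ge> 0" "\<psi> t = ennreal p" using less by (cases "\<psi> t") auto
  have "p < exp (- a)" using less p by (simp add: ennreal_less_iff)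
  then have "exp a * p < exp a * exp (- a)" by (intro mult_strict_left_mono) auto
  then have ap: "exp a * p < 1" by (simp flip: exp_add)
  \<comment> \<open>The geometric series in e^a p, that is, the solution of C = 1 + e^a p C. The
    summand 1 pays for the indicator, which is at most e^(t x) because t \<ge> 0.\<close>
  define C where "C = 1 / (1 - exp a * p)"
  have C: "C > 0" "1 + exp a * (C * p) = C" using ap by (auto simp: C_def field_simps)
  have "V x \<le> ennreal (exp (t * x) * C)"
  proof (rule V_least)
    fix x
    have "(\<integral>\<^sup>+ \<omega>. ennreal (exp (t * (x - T \<omega>)) * C) \<partial>N)
        = (\<integral>\<^sup>+ \<omega>. ennreal (exp (t * x) * C) * ennreal (exp (- t * T \<omega>)) \<partial>N)"
      using C by (intro nn_integral_cong)
        (simp add: algebra_simps exp_add flip: ennreal_mult' exp_minus exp_add)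
    also have "\<dots> = ennreal (exp (t * x) * C * p)"
      using C p(1) by (simp add: nn_integral_cmult ennreal_mult p(2)[unfolded laplace_def, simplified])
    finally have eq: "(\<integral>\<^sup>+ \<omega>. ennreal (exp (t * (x - T \<omega>)) * C) \<partial>N) = ennreal (exp (t * x) * C * p)" .
    have "indicator {0..} x \<le> ennreal (exp (t * x))"
      using t by (auto simp: indicator_def simp flip: ennreal_1)
    then have "indicator {0..} x + ennreal (exp a) * (\<integral>\<^sup>+ \<omega>. ennreal (exp (t * (x - T \<omega>)) * C) \<partial>N)
        \<le> ennreal (exp (t * x)) + ennreal (exp a * (exp (t * x) * C * p))"
      unfolding eq using C p by (simp add: ennreal_mult add_right_mono)
    also have "\<dots> = ennreal (exp (t * x) + exp a * (exp (t * x) * C * p))"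
      using C(1) p(1) by (intro ennreal_plus[symmetric]) auto
    also have "exp (t * x) + exp a * (exp (t * x) * C * p) = exp (t * x) * (1 + exp a * (C * p))"
      by (simp add: algebra_simps)
    finally show "indicator {0..} x + ennreal (exp a) * (\<integral>\<^sup>+ \<omega>. ennreal (exp (t * (x - T \<omega>)) * C) \<partial>N)
        \<le> ennreal (exp (t * x) * C)" unfolding C(2) .
  qed
  also have "\<dots> < \<infinity>" by simp
  finally show ?thesis .
qed

lemma finite_if_less_decay_rate:
  assumes "ereal a < decay_rate N T"
  shows "V x < \<infinity>"
proof -
  have "laplace_inf N T < ennreal (exp (- a))" using assms by (simp add: less_decay_rate_iff)
  then obtain t where "t \<ge> 0" "\<psi> t < ennreal (exp (- a))"
    unfolding laplace_inf_def INF_less_iff by auto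
  then show ?thesis by (rule finite_if_laplace_less)
qed

text \<open>A step of size 0 returns to the same point with weight e^a \<beta> \<ge> 1, so the
  equation at 0 gives 1 + V 0 \<le> V 0.\<close>

lemma infinite_if_atom:
  assumes "exp (- a) \<le> prob {\<omega> \<in> space N. T \<omega> = 0}" and "x \<ge> 0"
  shows "V x = \<infinity>"
proof -
  let ?\<beta> = "prob {\<omega> \<in> space N. T \<omega> = 0}"
  have "ennreal ?\<beta> * V 0 = (\<integral>\<^sup>+ \<omega>. V 0 * indicator {\<omega> \<in> space N. T \<omega> = 0} \<omega> \<partial>N)"
    by (subst nn_integral_cmult_indicator) (auto simp: emeasure_eq_measure mult.commute)
  also have "\<dots> \<le> (\<integral>\<^sup>+ \<omega>. V (0 - T \<omega>) \<partial>N)"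
    by (intro nn_integral_mono) (auto simp: indicator_def)
  finally have "ennreal (exp a) * (ennreal ?\<beta> * V 0) \<le> ennreal (exp a) * (\<integral>\<^sup>+ \<omega>. V (0 - T \<omega>) \<partial>N)"
    by (rule mult_left_mono) simp
  moreover have "V 0 \<le> ennreal (exp a) * (ennreal ?\<beta> * V 0)"
  proof -
    have "exp a * exp (- a) \<le> exp a * ?\<beta>" using assms by (intro mult_left_mono) auto
    then have "1 \<le> exp a * ?\<beta>" by (simp flip: exp_add)
    then have "ennreal 1 * V 0 \<le> ennreal (exp a * ?\<beta>) * V 0"
      by (intro mult_right_mono ennreal_leI) auto
    then show ?thesis by (simp add: ennreal_mult mult.assoc)
  qed
  ultimately have "1 + V 0 \<le> V 0"
    by (subst (2) V_eq) (auto intro: order_trans)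
  then have "V 0 = \<infinity>"
    by (cases "V 0") (auto simp flip: ennreal_1 ennreal_plus simp: top_unique)
  then show ?thesis using monoD[OF V_mono assms(2)] by (simp add: top_unique)
qed

text \<open>Infinite values spread to the left: for some e > 0, a step T \<le> -e has positive
  probability and makes V x depend on values at x + e and beyond. Hence it is enough to treat x > 0,
  where a source interval [0, x) is available.\<close>

lemma infinite_if_infinite_pos:
  assumes neg: "prob {\<omega> \<in> space N. T \<omega> < 0} > 0"
    and inf: "\<And>x. x > 0 \<Longrightarrow> V x = \<infinity>"
  shows "V x = \<infinity>"
proof -
  have "prob {\<omega> \<in> space N. - T \<omega> > 0} > 0" using neg by simp
  then obtain e where e: "e > 0" "prob {\<omega> \<in> space N. - T \<omega> \<ge> e} > 0"
    using prob_ge_pos[of "\<lambda>\<omega>. - T \<omega>"] by auto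
  have "V x = \<infinity>" if "x > - real n * e" for n x
    using that
  proof (induction n arbitrary: x)
    case (Suc n)
    have "\<infinity> * emeasure N {\<omega> \<in> space N. - T \<omega> \<ge> e} = (\<integral>\<^sup>+ \<omega>. \<infinity> * indicator {\<omega> \<in> space N. - T \<omega> \<ge> e} \<omega> \<partial>N)"
      by (subst nn_integral_cmult_indicator) auto
    also have "\<dots> \<le> (\<integral>\<^sup>+ \<omega>. V (x - T \<omega>) \<partial>N)"
    proof (rule nn_integral_mono)
      fix \<omega>
      show "\<infinity> * indicator {\<omega> \<in> space N. - T \<omega> \<ge> e} \<omega> \<le> V (x - T \<omega>)"
        using Suc.IH[of "x - T \<omega>"] Suc.prems by (auto simp: indicator_def algebra_simps)
    qed
    finally have "(\<integral>\<^sup>+ \<omega>. V (x - T \<omega>) \<partial>N) = \<infinity>"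
      using e(2) by (simp add: emeasure_eq_measure ennreal_top_mult top_unique)
    then show ?case by (subst V_eq) (simp add: ennreal_mult_top)
  qed (simp add: inf)
  moreover obtain n :: nat where "- x / e < real n" using reals_Archimedean2 by blast
  moreover from this have "- real n * e < x" using e by (simp add: field_simps)
  ultimately show ?thesis by blast
qed

text \<open>Exponential change of measure, with a weight \<open>\<rho>\<close> that may truncate the step: a finite \<open>V\<close>
  would give a bounded supersolution for a centred step. If the weighted mean is negative,
  the step is shifted to mean zero, which is harmless for a nondecreasing function.\<close>

lemma infinite_if_tilted_drift_nonpos:
  fixes \<rho> :: "'a \<Rightarrow> real"
  assumes g: "g \<ge> 0" and \<rho>: "integrable N \<rho>" "\<And>\<omega>. 0 \<le> \<rho> \<omega>" "(\<integral>\<omega>. \<rho> \<omega> \<partial>N) = 1"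
    and \<rho>_le: "\<And>\<omega>. \<rho> \<omega> \<le> exp a * exp (- g * T \<omega>)"
    and \<rho>T: "integrable N (\<lambda>\<omega>. \<rho> \<omega> * T \<omega>)" "(\<integral>\<omega>. \<rho> \<omega> * T \<omega> \<partial>N) \<le> 0"
    and drift: "g > 0 \<Longrightarrow> (\<integral>\<omega>. \<rho> \<omega> * T \<omega> \<partial>N) = 0"
    and x0: "x0 > 0"
  shows "V x0 = \<infinity>"
proof (rule ccontr)
  assume "V x0 \<noteq> \<infinity>"
  then obtain c where c: "c \<ge> 0" "V x0 = ennreal c" by (cases "V x0") auto
  define m where "m = (\<integral>\<omega>. \<rho> \<omega> * T \<omega> \<partial>N)"
  have [measurable]: "\<rho> \<in> borel_measurable N" using \<rho> by auto
  let ?Q = "density N (\<lambda>\<omega>. ennreal (\<rho> \<omega>))"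
  interpret Q: prob_space ?Q by (rule prob_space_density_weight) fact+
  \<comment> \<open>The cap c = V x0 makes \<open>u\<close> bounded. Constants are preserved by
    averaging under \<open>?Q\<close>, so the minimum still dominates its average. On [0, x0) the
    cap is inactive, because V is monotone and e^(-g x) \<le> 1; the source there survives with size
    at least e^(-g x0).\<close>
  define u where "u x = min (ennreal (exp (- g * x)) * V x) (ennreal c)" for x
  define w where "w x = enn2real (u x)" for x
  have [measurable]: "u \<in> borel_measurable borel" unfolding u_def[abs_def] by measurable
  have u_le: "u x \<le> ennreal c" for x by (simp add: u_def)
  have u_w: "u x = ennreal (w x)" for x
    unfolding w_def using u_le[of x] by (simp add: le_less_trans)
  have int_Q: "integrable ?Q f \<longleftrightarrow> integrable N (\<lambda>\<omega>. \<rho> \<omega> * f \<omega>)"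
    "(\<integral>\<omega>. f \<omega> \<partial>?Q) = (\<integral>\<omega>. \<rho> \<omega> * f \<omega> \<partial>N)" if "f \<in> borel_measurable N" for f :: "'a \<Rightarrow> real"
    using that \<rho>(2) by (simp_all add: integrable_density integral_density)
  show False
  proof (rule Q.centred_bounded_supersolution_trivial)
    show "integrable ?Q (\<lambda>\<omega>. T \<omega> - m)" "(\<integral>\<omega>. T \<omega> - m \<partial>?Q) = 0"
      using \<rho> \<rho>T Q.prob_space by (simp_all add: int_Q right_diff_distrib m_def)
    show "w \<in> borel_measurable borel" unfolding w_def[abs_def] by measurable
    show "0 \<le> w x" "w x \<le> c" for x
      using u_le[of x] c(1) by (simp_all add: w_def enn2real_leI)
    show "exp (- g * x0) > 0" "x0 > 0" using x0 by auto
    show "ennreal (exp (- g * x0) * indicator {0..<x0} x) + (\<integral>\<^sup>+ \<omega>. ennreal (w (x - (T \<omega> - m))) \<partial>?Q)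
        \<le> ennreal (w x)" for x
    proof -
      \<comment> \<open>For g > 0 the factor e^(-g x) can destroy monotonicity of \<open>u\<close>,
        so a nonzero shift is allowed only at g = 0; this is why \<open>drift\<close> demands mean
        zero when g > 0.\<close>
      have "u (x - (T \<omega> - m)) \<le> u (x - T \<omega>)" for \<omega>
      proof (cases "g = 0")
        case True
        have "V (x - (T \<omega> - m)) \<le> V (x - T \<omega>)"
          using \<rho>T(2) by (intro monoD[OF V_mono]) (simp add: m_def)
        then show ?thesis using True by (simp add: u_def min.coboundedI1)
      next
        case False
        then have "m = 0" using drift g by (simp add: m_def)
        then show ?thesis by simp
      qed
      then have "(\<integral>\<^sup>+ \<omega>. u (x - (T \<omega> - m)) \<partial>?Q) \<le> (\<integral>\<^sup>+ \<omega>. u (x - T \<omega>) \<partial>?Q)"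
        by (intro nn_integral_mono)
      also have le: "\<dots> \<le> min (ennreal (exp (- g * x)) * (ennreal (exp a) * (\<integral>\<^sup>+ \<omega>. V (x - T \<omega>) \<partial>N))) (ennreal c)"
      proof (rule min.boundedI)
        have "(\<integral>\<^sup>+ \<omega>. u (x - T \<omega>) \<partial>?Q) = (\<integral>\<^sup>+ \<omega>. ennreal (\<rho> \<omega>) * u (x - T \<omega>) \<partial>N)"
          by (rule nn_integral_density) measurable
        also have "\<dots> \<le> (\<integral>\<^sup>+ \<omega>. ennreal (exp (- g * x) * exp a) * V (x - T \<omega>) \<partial>N)"
        proof (rule nn_integral_mono)
          fix \<omega>
          have "ennreal (\<rho> \<omega>) * u (x - T \<omega>)
              \<le> ennreal (exp a * exp (- g * T \<omega>)) * (ennreal (exp (- g * (x - T \<omega>))) * V (x - T \<omega>))"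
            using \<rho>_le[of \<omega>] by (intro mult_mono ennreal_leI) (auto simp: u_def)
          also have "\<dots> = ennreal (exp a * exp (- g * T \<omega>) * exp (- g * (x - T \<omega>))) * V (x - T \<omega>)"
            by (simp add: ennreal_mult mult.assoc)
          also have "exp a * exp (- g * T \<omega>) * exp (- g * (x - T \<omega>)) = exp (- g * x) * exp a"
            by (simp add: algebra_simps flip: exp_add)
          finally show "ennreal (\<rho> \<omega>) * u (x - T \<omega>) \<le> ennreal (exp (- g * x) * exp a) * V (x - T \<omega>)" .
        qed
        also have "\<dots> = ennreal (exp (- g * x)) * (ennreal (exp a) * (\<integral>\<^sup>+ \<omega>. V (x - T \<omega>) \<partial>N))"
          by (subst nn_integral_cmult) (auto simp: ennreal_mult mult.assoc)
        finally show "(\<integral>\<^sup>+ \<omega>. u (x - T \<omega>) \<partial>?Q)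
          \<le> ennreal (exp (- g * x)) * (ennreal (exp a) * (\<integral>\<^sup>+ \<omega>. V (x - T \<omega>) \<partial>N))" .
        have "(\<integral>\<^sup>+ \<omega>. u (x - T \<omega>) \<partial>?Q) \<le> (\<integral>\<^sup>+ \<omega>. ennreal c \<partial>?Q)"
          by (intro nn_integral_mono u_le)
        then show "(\<integral>\<^sup>+ \<omega>. u (x - T \<omega>) \<partial>?Q) \<le> ennreal c"
          by (simp add: Q.emeasure_space_1 del: space_density)
      qed
      finally have *: "(\<integral>\<^sup>+ \<omega>. u (x - (T \<omega> - m)) \<partial>?Q)
        \<le> min (ennreal (exp (- g * x)) * (ennreal (exp a) * (\<integral>\<^sup>+ \<omega>. V (x - T \<omega>) \<partial>N))) (ennreal c)" .
      show ?thesis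
      proof (cases "x \<in> {0..<x0}")
        case True
        have "u x = ennreal (exp (- g * x)) * V x"
        proof -
          have "ennreal (exp (- g * x)) * V x \<le> 1 * V x0"
            using True g by (intro mult_mono monoD[OF V_mono]) (auto simp flip: ennreal_1)
          then show ?thesis using c by (simp add: u_def min_absorb1)
        qed
        also have "\<dots> = ennreal (exp (- g * x)) * (1 + ennreal (exp a) * (\<integral>\<^sup>+ \<omega>. V (x - T \<omega>) \<partial>N))"
          using True by (subst V_eq) simp
        also have "\<dots> = ennreal (exp (- g * x)) + ennreal (exp (- g * x)) * (ennreal (exp a) * (\<integral>\<^sup>+ \<omega>. V (x - T \<omega>) \<partial>N))"
          by (simp add: distrib_left)
        also have "\<dots> \<ge> ennreal (exp (- g * x0)) + (\<integral>\<^sup>+ \<omega>. u (x - (T \<omega> - m)) \<partial>?Q)"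
          using * True g by (intro add_mono ennreal_leI) (auto intro: mult_left_mono)
        finally show ?thesis using True by (simp add: u_w)
      next
        case False
        have "(\<integral>\<^sup>+ \<omega>. u (x - (T \<omega> - m)) \<partial>?Q) \<le> u x"
          unfolding u_def[of x]
        proof (rule min.mono[THEN order_trans[OF *], OF mult_left_mono order_refl])
          show "ennreal (exp a) * (\<integral>\<^sup>+ \<omega>. V (x - T \<omega>) \<partial>N) \<le> V x"
            by (subst V_eq[of x]) simp
        qed simp
        then show ?thesis using False by (simp add: u_w)
      qed
    qed
  qed
qed

text \<open>If every large cut-off had some t with truncated transform at most e^(-a), compactness
  would give \<psi> t \<le> e^(-a) for some t. So some cut-off keeps the whole truncated transform
  above e^(-a), and its minimiser serves as the tilting parameter.\<close>

lemma infinite_if_less_laplace_inf: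
  assumes neg: "prob {\<omega> \<in> space N. T \<omega> < 0} > 0" and less: "ennreal (exp (- a)) < laplace_inf N T"
  shows "V x = \<infinity>"
proof (rule infinite_if_infinite_pos[OF neg])
  fix x :: real assume "x > 0"
  from trunc_laplace_attains_min[OF neg]
  obtain b0 where b0: "\<forall>b\<ge>b0. \<exists>g\<ge>0. \<forall>t\<ge>0. trunc_laplace b g \<le> trunc_laplace b t" ..
  have "\<exists>b\<ge>b0. \<forall>t\<ge>0. trunc_laplace b t > exp (- a)"
  proof (rule ccontr)
    assume "\<not> ?thesis"
    then have "\<exists>t\<ge>0. trunc_laplace b t \<le> exp (- a)" if "b \<ge> b0" for b
      using that by (simp add: not_less)
    then have "\<exists>t\<ge>0. \<psi> t \<le> ennreal (exp (- a))"
      by (rule laplace_le_if_trunc_le[OF neg])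
    then obtain t where "t \<ge> 0" "\<psi> t \<le> ennreal (exp (- a))" by (elim exE conjE)
    with laplace_inf_le[of t] less show False by simp
  qed
  then obtain b where "b \<ge> b0" and gt': "\<forall>t\<ge>0. trunc_laplace b t > exp (- a)" by (elim exE conjE)
  then have gt: "trunc_laplace b t > exp (- a)" if "t \<ge> 0" for t using that by simp
  from b0 \<open>b \<ge> b0\<close> have "\<exists>g\<ge>0. \<forall>t\<ge>0. trunc_laplace b g \<le> trunc_laplace b t" by simp
  then obtain g where g: "g \<ge> 0" and min': "\<forall>t\<ge>0. trunc_laplace b g \<le> trunc_laplace b t" by (elim exE conjE)
  then have min: "trunc_laplace b g \<le> trunc_laplace b t" if "t \<ge> 0" for t using that by simp
  \<comment> \<open>The normalising constant of the tilted truncated law. Because p > e^(-a), the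
    normalised weight stays below e^a exp (-g T), the only comparison with the renewal equation that
    is required.\<close>
  define p where "p = trunc_laplace b g"
  have p: "p > exp (- a)" "p > 0" using gt[OF g] less_trans[OF exp_gt_zero gt[OF g]] by (auto simp: p_def)
  define D where "D = (\<integral>\<omega>. indicator {-b..b} (T \<omega>) * exp (- g * T \<omega>) * T \<omega> \<partial>N)"
  have deriv: "DERIV (trunc_laplace b) g :> - D" unfolding D_def by (rule DERIV_trunc_laplace)
  \<comment> \<open>At a minimiser over [0, \<infinity>) the derivative -D cannot be negative; at g
    = 0 nothing more can be said, while for g > 0 it must vanish.\<close>
  have D_le: "D \<le> 0"
  proof (rule ccontr)
    assume "\<not> D \<le> 0"
    then obtain d where "d > 0" "\<And>h. 0 < h \<Longrightarrow> h < d \<Longrightarrow> trunc_laplace b (g + h) < trunc_laplace b g"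
      using DERIV_neg_dec_right[OF deriv] by auto
    from this(2)[of "d / 2"] this(1) show False using min[of "g + d / 2"] g by simp
  qed
  have D_eq: "D = 0" if "g > 0"
    using DERIV_local_min[OF deriv that] min by auto
  define \<rho> where "\<rho> \<omega> = indicator {-b..b} (T \<omega>) * exp (- g * T \<omega>) / p" for \<omega>
  have \<rho>T: "\<rho> \<omega> * T \<omega> = indicator {-b..b} (T \<omega>) * exp (- g * T \<omega>) * T \<omega> / p" for \<omega>
    by (simp add: \<rho>_def)
  show "V x = \<infinity>"
  proof (rule infinite_if_tilted_drift_nonpos[OF g _ _ _ _ _ _ _ \<open>x > 0\<close>])
    show "integrable N \<rho>" unfolding \<rho>_def using integrable_trunc[of b g] by simp
    show "(\<integral>\<omega>. \<rho> \<omega> \<partial>N) = 1"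
      unfolding \<rho>_def using p by (simp add: p_def trunc_laplace_def)
    show "0 \<le> \<rho> \<omega>" for \<omega> using p by (simp add: \<rho>_def)
    have "1 / p \<le> exp a" using p by (simp add: field_simps exp_minus)
    then show "\<rho> \<omega> \<le> exp a * exp (- g * T \<omega>)" for \<omega>
      using mult_right_mono[of "1 / p" "exp a" "exp (- g * T \<omega>)"] by (simp add: \<rho>_def indicator_def)
    show "integrable N (\<lambda>\<omega>. \<rho> \<omega> * T \<omega>)"
      unfolding \<rho>T using integrable_trunc_times[of b g] by simp
    show "(\<integral>\<omega>. \<rho> \<omega> * T \<omega> \<partial>N) \<le> 0"
      unfolding \<rho>T using D_le p unfolding D_def by (simp add: divide_nonpos_pos)
    show "(\<integral>\<omega>. \<rho> \<omega> * T \<omega> \<partial>N) = 0" if "g > 0"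
      unfolding \<rho>T using D_eq[OF that] unfolding D_def by simp
  qed
qed

section \<open>The critical rate\<close>

context
  fixes g :: real
  assumes g: "g > 0" and psi_g: "\<psi> g = ennreal (exp (- a))"
    and int_T: "integrable N (\<lambda>\<omega>. exp (- g * T \<omega>) * T \<omega>)"
begin

lemma tilt_weight:
  "integrable N (\<lambda>\<omega>. exp a * exp (- g * T \<omega>))" "(\<integral>\<omega>. exp a * exp (- g * T \<omega>) \<partial>N) = 1"
proof -
  have fin: "\<psi> g < \<infinity>" by (simp add: psi_g)
  show "integrable N (\<lambda>\<omega>. exp a * exp (- g * T \<omega>))"
    using integrable_exp_if_laplace_finite(1)[OF fin] by simp
  have "(\<integral>\<omega>. exp (- g * T \<omega>) \<partial>N) = exp (- a)"
    using integrable_exp_if_laplace_finite(2)[OF fin] unfolding psi_g by (subst (asm) ennreal_inj) auto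
  then show "(\<integral>\<omega>. exp a * exp (- g * T \<omega>) \<partial>N) = 1"
    by (simp only: Bochner_Integration.integral_mult_right_zero) (simp flip: exp_add)
qed

lemma infinite_if_tilted_drift_zero:
  assumes neg: "prob {\<omega> \<in> space N. T \<omega> < 0} > 0"
    and zero: "(\<integral>\<omega>. exp (- g * T \<omega>) * T \<omega> \<partial>N) = 0"
  shows "V x = \<infinity>"
proof (rule infinite_if_infinite_pos[OF neg])
  fix x :: real assume "x > 0"
  show "V x = \<infinity>"
    by (rule infinite_if_tilted_drift_nonpos[where g = g and \<rho> = "\<lambda>\<omega>. exp a * exp (- g * T \<omega>)"])
       (use g tilt_weight int_T zero \<open>x > 0\<close> in \<open>simp_all add: mult.assoc\<close>)
qed

lemma finite_if_tilted_drift_pos: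
  assumes pos: "(\<integral>\<omega>. exp (- g * T \<omega>) * T \<omega> \<partial>N) > 0"
  shows "V x < \<infinity>"
proof -
  let ?\<rho> = "\<lambda>\<omega>. exp a * exp (- g * T \<omega>)"
  let ?Q = "density N (\<lambda>\<omega>. ennreal (?\<rho> \<omega>))"
  interpret Q: prob_space ?Q by (rule prob_space_density_weight) (use tilt_weight in auto)
  have "integrable ?Q T" "(\<integral>\<omega>. T \<omega> \<partial>?Q) > 0"
    using int_T pos by (simp_all add: integrable_density integral_density mult.assoc)
  from Q.positive_drift_supersolution[OF this]
  obtain r :: "real \<Rightarrow> real" and \<kappa> d where r [measurable]: "r \<in> borel_measurable borel"
    and r_bounds: "\<And>x. 0 \<le> r x" "\<And>x. r x \<le> 1" and "\<kappa> > 0" "d > 0"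
    and super: "\<And>x. ennreal (\<kappa> * indicator {0..<d} x) + (\<integral>\<^sup>+ \<omega>. ennreal (r (x - T \<omega>)) \<partial>?Q) \<le> ennreal (r x)"
    by blast
  \<comment> \<open>After tilting, the source is e^(-g x) on [0, \<infinity>), and on [k d, k d + d)
    it is at most e^(-g k d). The copy of r shifted by k d has source \<kappa> on that interval,
    hence the division by \<kappa>. As r \<le> 1, the sum is dominated by a geometric series with
    ratio e^(-g d) < 1.\<close>
  define e where "e k = exp (- g * (real k * d)) / \<kappa>" for k
  have e: "e k \<ge> 0" for k using \<open>\<kappa> > 0\<close> by (simp add: e_def)
  define w where "w x = (\<Sum>k. ennreal (exp (g * x)) * (ennreal (e k) * ennreal (r (x - real k * d))))" for x
  have "V x \<le> w x"
  proof (rule V_least)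
    fix x
    have "ennreal (exp a) * (\<integral>\<^sup>+ \<omega>. w (x - T \<omega>) \<partial>N) = (\<integral>\<^sup>+ \<omega>. ennreal (exp a) * w (x - T \<omega>) \<partial>N)"
      unfolding w_def by (rule nn_integral_cmult[symmetric]) measurable
    also have "\<dots> = (\<integral>\<^sup>+ \<omega>. ennreal (?\<rho> \<omega>) * (\<Sum>k. ennreal (exp (g * x)) *
        (ennreal (e k) * ennreal (r (x - real k * d - T \<omega>)))) \<partial>N)"
    proof (rule nn_integral_cong)
      fix \<omega>
      have "ennreal (exp a) * (ennreal (exp (g * (x - T \<omega>))) * z) = ennreal (?\<rho> \<omega>) * (ennreal (exp (g * x)) * z)" for z
      proof -
        have "exp a * exp (g * (x - T \<omega>)) = ?\<rho> \<omega> * exp (g * x)"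
          by (simp add: algebra_simps flip: exp_add)
        then have "ennreal (exp a) * ennreal (exp (g * (x - T \<omega>))) = ennreal (?\<rho> \<omega>) * ennreal (exp (g * x))"
          by (simp flip: ennreal_mult)
        then show ?thesis by (simp add: mult.assoc[symmetric])
      qed
      then show "ennreal (exp a) * w (x - T \<omega>) = ennreal (?\<rho> \<omega>) * (\<Sum>k. ennreal (exp (g * x)) *
        (ennreal (e k) * ennreal (r (x - real k * d - T \<omega>))))"
        unfolding w_def by (simp add: diff_diff_eq add.commute[of "T \<omega>"] flip: ennreal_suminf_cmult)
    qed
    also have "\<dots> = (\<integral>\<^sup>+ \<omega>. (\<Sum>k. ennreal (exp (g * x)) *
        (ennreal (e k) * ennreal (r (x - real k * d - T \<omega>)))) \<partial>?Q)"
      by (rule nn_integral_density[symmetric]) measurable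
    also have "\<dots> = (\<Sum>k. ennreal (exp (g * x)) *
        (ennreal (e k) * (\<integral>\<^sup>+ \<omega>. ennreal (r (x - real k * d - T \<omega>)) \<partial>?Q)))"
      by (subst nn_integral_suminf) (auto simp: nn_integral_cmult)
    finally have eq: "ennreal (exp a) * (\<integral>\<^sup>+ \<omega>. w (x - T \<omega>) \<partial>N) = \<dots>" .
    have "indicator {0..} x \<le> (\<Sum>k. ennreal (exp (g * x)) * (ennreal (e k) * ennreal (\<kappa> * indicator {0..<d} (x - real k * d))))"
      (is "_ \<le> (\<Sum>k. ?s k)")
    proof (cases "x \<ge> 0")
      case True
      define k where "k = nat \<lfloor>x / d\<rfloor>"
      have "real k \<le> x / d" "x / d < real k + 1"
        using True \<open>d > 0\<close> by (auto simp: k_def)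
      then have k: "real k * d \<le> x" "x < real k * d + d"
        using \<open>d > 0\<close> by (simp_all add: field_simps)
      have "exp (g * x) * (e k * \<kappa>) = exp (g * (x - real k * d))"
        using \<open>\<kappa> > 0\<close> by (simp add: e_def algebra_simps flip: exp_add)
      also have "\<dots> \<ge> 1" using g k by simp
      finally have "1 \<le> exp (g * x) * (e k * \<kappa>)" .
      then have "ennreal 1 \<le> ennreal (exp (g * x) * (e k * \<kappa>))" by (rule ennreal_leI)
      also have "\<dots> = ?s k" using k e \<open>\<kappa> > 0\<close> by (simp add: ennreal_mult)
      also have "\<dots> \<le> (\<Sum>k. ?s k)"
        using sum_le_suminf[of ?s "{k}"] by simp
      finally show ?thesis using True by simp
    qed simp
    then have "indicator {0..} x + ennreal (exp a) * (\<integral>\<^sup>+ \<omega>. w (x - T \<omega>) \<partial>N)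
      \<le> (\<Sum>k. ?s k) + (\<Sum>k. ennreal (exp (g * x)) *
        (ennreal (e k) * (\<integral>\<^sup>+ \<omega>. ennreal (r (x - real k * d - T \<omega>)) \<partial>?Q)))"
      unfolding eq by (rule add_right_mono)
    also have "\<dots> = (\<Sum>k. ennreal (exp (g * x)) * (ennreal (e k) *
        (ennreal (\<kappa> * indicator {0..<d} (x - real k * d)) + (\<integral>\<^sup>+ \<omega>. ennreal (r (x - real k * d - T \<omega>)) \<partial>?Q))))"
      unfolding distrib_left by (rule suminf_add) auto
    also have "\<dots> \<le> w x"
      unfolding w_def by (intro suminf_le mult_left_mono super summableI) auto
    finally show "indicator {0..} x + ennreal (exp a) * (\<integral>\<^sup>+ \<omega>. w (x - T \<omega>) \<partial>N) \<le> w x" .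
  qed
  also have "w x \<le> (\<Sum>k. ennreal (exp (g * x) / \<kappa> * exp (- g * d) ^ k))"
    unfolding w_def
  proof (intro suminf_le summableI)
    fix k
    have "exp (g * x) * (e k * r (x - real k * d)) \<le> exp (g * x) * (e k * 1)"
      by (intro mult_left_mono r_bounds e) auto
    also have "\<dots> = exp (g * x) / \<kappa> * exp (- g * d) ^ k"
      by (simp add: e_def mult_ac flip: exp_of_nat_mult)
    finally show "ennreal (exp (g * x)) * (ennreal (e k) * ennreal (r (x - real k * d)))
        \<le> ennreal (exp (g * x) / \<kappa> * exp (- g * d) ^ k)"
      using e r_bounds by (simp add: ennreal_leI flip: ennreal_mult)
  qed
  also have "\<dots> < \<infinity>"
  proof -
    have "summable (\<lambda>k. exp (g * x) / \<kappa> * exp (- g * d) ^ k)"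
      using g \<open>d > 0\<close> by (intro summable_mult summable_geometric) simp
    then show ?thesis
      using \<open>\<kappa> > 0\<close> by (subst suminf_ennreal2) auto
  qed
  finally show ?thesis .
qed

end
end

text \<open>At a = R the existence of the left derivative and the integrability of exp (-\<gamma>0
  T) T are part of the conclusion: \<open>vector_derivative\<close> and the Bochner integral have
  default values where they are undefined, so the formula for the derivative alone would not express
  its meaning.\<close>

theorem theorem2p1:
  fixes N :: "'a measure" and T :: "'a \<Rightarrow> real"
    and M :: "'b measure" and X :: "nat \<Rightarrow> 'b \<Rightarrow> real"
    and a :: real
  defines "\<psi> \<equiv> laplace N T"
    and "\<psi>' \<equiv> laplace_left_deriv N T"
    and "R \<equiv> decay_rate N T"
    and "\<gamma>0 \<equiv> laplace_argmin N T"
    and "V \<equiv> exp_renewal M X a"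
    and "\<beta> \<equiv> measure N {\<omega> \<in> space N. T \<omega> = 0}"
  assumes "prob_space N" and "T \<in> borel_measurable N"
    and "prob_space M"
    and "prob_space.indep_vars M (\<lambda>_. borel) X UNIV"
    and "\<And>n. distr M borel (X n) = distr N borel T"
    and "measure N {\<omega> \<in> space N. T \<omega> = 0} \<noteq> 1"
    and "a > 0"
  shows
    "(measure N {\<omega> \<in> space N. T \<omega> < 0} > 0 \<longrightarrow>
        (ereal a < R \<longrightarrow> (\<forall>x. V x < \<infinity>)) \<and>
        (ereal a = R \<longrightarrow>
           ((\<lambda>t. enn2real (\<psi> t)) has_real_derivative \<psi>' \<gamma>0) (at_left \<gamma>0) \<and>
           integrable N (\<lambda>\<omega>. exp (- \<gamma>0 * T \<omega>) * T \<omega>) \<and>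
           - \<psi>' \<gamma>0 = (\<integral>\<omega>. exp (- \<gamma>0 * T \<omega>) * T \<omega> \<partial>N) \<and>
           (- \<psi>' \<gamma>0 > 0 \<longrightarrow> (\<forall>x. V x < \<infinity>))) \<and>
        (ereal a > R \<longrightarrow> (\<forall>x. V x = \<infinity>)) \<and>
        (ereal a = R \<longrightarrow>
           (\<psi>' \<gamma>0 = 0 \<longleftrightarrow> \<not> - \<psi>' \<gamma>0 > 0) \<and>
           (\<psi>' \<gamma>0 = 0 \<longrightarrow> (\<forall>x. V x = \<infinity>))))
     \<and> (measure N {\<omega> \<in> space N. T \<omega> > 0} = 1 \<longrightarrow> (\<forall>x. V x < \<infinity>))
     \<and> (measure N {\<omega> \<in> space N. T \<omega> \<ge> 0} = 1 \<and> \<beta> > 0 \<longrightarrow>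
          R = ereal (- ln \<beta>) \<and>
          (ereal a < R \<longrightarrow> (\<forall>x. V x < \<infinity>)) \<and>
          (ereal a \<ge> R \<longrightarrow> (\<forall>x\<ge>0. V x = \<infinity>)))"
proof -
  interpret real_random_variable N T
    using \<open>prob_space N\<close> \<open>T \<in> borel_measurable N\<close>
    by (simp add: real_random_variable_def real_random_variable_axioms_def)
  interpret renewal_equation N T a V
    unfolding V_def by (rule renewal_equation_exp_renewal) fact+
  let ?I = "\<integral>\<omega>. exp (- \<gamma>0 * T \<omega>) * T \<omega> \<partial>N"
  have crit: "\<gamma>0 > 0" "laplace N T \<gamma>0 = ennreal (exp (- a))"
    "integrable N (\<lambda>\<omega>. exp (- \<gamma>0 * T \<omega>) * T \<omega>)"
    "((\<lambda>t. enn2real (laplace N T t)) has_real_derivative \<psi>' \<gamma>0) (at_left \<gamma>0)"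
    "- \<psi>' \<gamma>0 = ?I" "?I \<ge> 0"
    if neg: "prob {\<omega> \<in> space N. T \<omega> < 0} > 0" and R: "ereal a = R"
  proof -
    have inf: "laplace_inf N T = ennreal (exp (- a))"
      using R by (simp add: R_def eq_decay_rate_iff)
    have "\<gamma>0 \<ge> 0" and arg: "laplace N T \<gamma>0 = laplace_inf N T"
      using laplace_argmin[OF neg] assms(12) by (simp_all add: \<gamma>0_def)
    show psi: "laplace N T \<gamma>0 = ennreal (exp (- a))" using arg inf by simp
    \<comment> \<open>Here a > 0 enters: \<psi>(0) = 1 differs from e^(-a). Positivity of \<gamma>0
      makes room for a left derivative within [0, \<infinity>).\<close>
    have "\<gamma>0 \<noteq> 0"
    proof
      assume "\<gamma>0 = 0"
      then have "ennreal (exp (- a)) = ennreal 1" using psi laplace_0 by simp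
      then have "exp (- a) = 1" by (subst (asm) ennreal_inj) auto
      then show False using \<open>a > 0\<close> by simp
    qed
    then show "\<gamma>0 > 0" using \<open>\<gamma>0 \<ge> 0\<close> by simp
    have fin: "laplace N T \<gamma>0 < \<infinity>" by (simp add: psi)
    have min: "laplace N T \<gamma>0 \<le> laplace N T s" if "s \<ge> 0" for s
      using laplace_inf_le[OF that] arg by simp
    note * = left_derivative_at_minimiser[OF \<open>\<gamma>0 > 0\<close> fin min]
    show "integrable N (\<lambda>\<omega>. exp (- \<gamma>0 * T \<omega>) * T \<omega>)" by (rule *(1))
    show "?I \<ge> 0" by (rule *(3))
    have "\<psi>' \<gamma>0 = - ?I"
      unfolding \<psi>'_def laplace_left_deriv_def
      using *(2) by (intro vector_derivative_within)
        (simp_all add: has_real_derivative_iff_has_vector_derivative trivial_limit_at_left_real)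
    then show "- \<psi>' \<gamma>0 = ?I"
      "((\<lambda>t. enn2real (laplace N T t)) has_real_derivative \<psi>' \<gamma>0) (at_left \<gamma>0)"
      using *(2) by simp_all
  qed
  show ?thesis
  proof (intro conjI impI allI)
    assume "measure N {\<omega> \<in> space N. T \<omega> < 0} > 0" "ereal a < R"
    then show "V x < \<infinity>" for x by (intro finite_if_less_decay_rate) (simp add: R_def)
  next
    assume neg: "measure N {\<omega> \<in> space N. T \<omega> < 0} > 0" and R: "ereal a = R"
    note c = crit[OF this]
    show "((\<lambda>t. enn2real (\<psi> t)) has_real_derivative \<psi>' \<gamma>0) (at_left \<gamma>0)"
      "integrable N (\<lambda>\<omega>. exp (- \<gamma>0 * T \<omega>) * T \<omega>)" "- \<psi>' \<gamma>0 = ?I"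
      using c by (simp_all add: \<psi>_def)
    show "V x < \<infinity>" if "- \<psi>' \<gamma>0 > 0" for x
      using finite_if_tilted_drift_pos[OF c(1-3)] that unfolding c(5) by simp
  next
    assume "measure N {\<omega> \<in> space N. T \<omega> < 0} > 0" "ereal a > R"
    then show "V x = \<infinity>" for x
      by (intro infinite_if_less_laplace_inf) (simp_all add: R_def decay_rate_less_iff)
  next
    assume neg: "measure N {\<omega> \<in> space N. T \<omega> < 0} > 0" and R: "ereal a = R"
    note c = crit[OF this]
    show "\<psi>' \<gamma>0 = 0 \<longleftrightarrow> \<not> - \<psi>' \<gamma>0 > 0" using c(5,6) by linarith
    show "V x = \<infinity>" if "\<psi>' \<gamma>0 = 0" for x
      using infinite_if_tilted_drift_zero[OF c(1-3) neg] that c(5) by simp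
  next
    fix x
    assume "measure N {\<omega> \<in> space N. T \<omega> > 0} = 1"
    then have pos: "AE \<omega> in N. T \<omega> > 0" by (subst (asm) prob_Collect_eq_1) auto
    \<comment> \<open>Without an atom at 0 the infimum of \<psi> is 0 and R is infinite, so every
      real a is subcritical.\<close>
    then have "prob {\<omega> \<in> space N. T \<omega> = 0} = 0" by (subst prob_eq_0) auto
    moreover have "AE \<omega> in N. T \<omega> \<ge> 0" using pos by eventually_elim simp
    ultimately have "laplace_inf N T = 0" by (simp add: laplace_inf_nonneg)
    then show "V x < \<infinity>" by (intro finite_if_less_decay_rate) (simp add: decay_rate_def)
  next
    assume nonneg: "measure N {\<omega> \<in> space N. T \<omega> \<ge> 0} = 1 \<and> \<beta> > 0"
    then have "AE \<omega> in N. T \<omega> \<ge> 0" by (subst (asm) prob_Collect_eq_1) auto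
    then have inf: "laplace_inf N T = ennreal \<beta>" by (simp add: laplace_inf_nonneg \<beta>_def)
    then show R: "R = ereal (- ln \<beta>)"
      using nonneg by (simp add: R_def decay_rate_def ennreal_eq_0_iff)
    show "V x < \<infinity>" if "ereal a < R" for x
      using that by (intro finite_if_less_decay_rate) (simp add: R_def)
    show "V x = \<infinity>" if "ereal a \<ge> R" "0 \<le> x" for x
    proof (rule infinite_if_atom)
      have "- a \<le> ln \<beta>" using that R by simp
      then have "exp (- a) \<le> exp (ln \<beta>)" by (simp only: exp_le_cancel_iff)
      also have "\<dots> = \<beta>" using nonneg by (intro exp_ln) simp
      finally show "exp (- a) \<le> prob {\<omega> \<in> space N. T \<omega> = 0}" by (simp only: \<beta>_def)
    qed fact
  qed
qed

end
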